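(* The Godbillon-Vey invariant is represented by a non-zero class in each homology group of the commutative diagram $$\begin{array}{ccc} HL_3(W^P_1)&\xrightarrow{(\pi_1)_*}&H^{\mathrm{Lie}}_3(W^P_1)\\ \downarrow{\scriptstyle\mu_1}&&\downarrow{\scriptstyle\mu_2}\\ HL_3(U(W^P_1))&\xrightarrow{(\pi_1)_*}&H^{\mathrm{Lie}}_3(U(W^P_1))\\ \downarrow{\scriptstyle\varphi_*}&&\downarrow{\scriptstyle\theta_*}\\ HH_2(U(W^P_1))&\xrightarrow{\ I\ }&HC_2(U(W^P_1)). \end{array}$$ That is, the diagram commutes, and there is a class in $HL_3(W^P_1)$ whose image in $H^{\mathrm{Lie}}_3(W^P_1)$ is the Godbillon-Vey class and whose images in all the groups of the diagram are non-zero.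
   Context: $W^P_1=\mathbf R[x]\otimes_{\mathbf R}\langle\frac{d}{dx}\rangle$ is the real Lie algebra of polynomial vector fields in one variable, $[x^n\frac{d}{dx},x^k\frac{d}{dx}]=(k-n)x^{n+k-1}\frac{d}{dx}$; $e_i=x^{i+1}\frac{d}{dx}$ for $i\ge-1$. $U(W^P_1)$ is its universal enveloping algebra, also regarded as a Lie algebra via $[a,b]=ab-ba$; $\mu_1$ and $\mu_2$ are induced on $HL_*$ and $H^{\mathrm{Lie}}_*$ by the inclusion $W^P_1\hookrightarrow U(W^P_1)$. The Godbillon-Vey class in $H^{\mathrm{Lie}}_3(W^P_1)$ is the class of the cycle $e_{-1}\wedge e_0\wedge e_1$. $HL_*(\mathsf g)$ is the homology of $CL_*(\mathsf g)$, with $\mathsf g^{\otimes n}$ in degree $n$ and $d(g_1,\ldots,g_n)=\sum_{1\le i<j\le n}(-1)^j(g_1,\ldots,g_{i-1},[g_i,g_j],g_{i+1},\ldots,\hat g_j,\ldots,g_n)$; $H^{\mathrm{Lie}}_*(\mathsf g)$ is the homology of $\Lambda^*(\mathsf g)$, with $\mathsf g^{\wedge n}$ in degree $n$ and the same differential formula on exterior powers; $(\pi_1)_*$ is induced by the canonical projection $\pi_1:\mathsf g^{\otimes n}\to\mathsf g^{\wedge n}$. For an algebra $A$ over $\mathbf R$, $HH_*(A)$ is the homology of $CHH_n(A)=A^{\otimes(n+1)}$ with $b(a_0,\ldots,a_n)=\sum_{i=0}^{n-1}(-1)^i(a_0,\ldots,a_ia_{i+1},\ldots,a_n)+(-1)^n(a_na_0,a_1,\ldots,a_{n-1})$;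 $HC_*(A)$ is the homology of $C^\lambda_n(A)=A^{\otimes(n+1)}/\operatorname{Im}(1-t)$, $t(a_0,\ldots,a_n)=(-1)^n(a_n,a_0,\ldots,a_{n-1})$, with boundary induced by $b$; $I$ is induced by the projection $CHH_*(A)\to C^\lambda_*(A)$. The chain maps $\varphi:CL_{*+1}(A)\to CHH_*(A)$ and $\theta:\Lambda^{*+1}(A)\to C^\lambda_*(A)$ send $(a_0,\ldots,a_n)$, respectively $a_0\wedge\cdots\wedge a_n$, to $\sum_{\sigma\in S_n}(\operatorname{sgn}\sigma)(a_0,a_{\sigma^{-1}(1)},\ldots,a_{\sigma^{-1}(n)})$; they induce $\varphi_*:HL_{*+1}(A)\to HH_*(A)$ and $\theta_*:H^{\mathrm{Lie}}_{*+1}(A)\to HC_*(A)$. *)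

theory Defs
  imports
    Complex_Main
    "HOL-Library.Poly_Mapping"
    "HOL-Computational_Algebra.Polynomial"
    "HOL-Combinatorics.Permutations"
    "HOL-Algebra.Coset"
begin

section \<open>Tensor algebra of a real vector space\<close>

instantiation poly_mapping :: (type, real_vector) real_vector
begin

definition scaleR_poly_mapping :: "real \<Rightarrow> ('a \<Rightarrow>\<^sub>0 'b) \<Rightarrow> ('a \<Rightarrow>\<^sub>0 'b)"
  where "scaleR_poly_mapping c = Poly_Mapping.map (scaleR c)"

lemma lookup_scaleR: "Poly_Mapping.lookup (c *\<^sub>R p) k = c *\<^sub>R Poly_Mapping.lookup p k"
  for p :: "'a \<Rightarrow>\<^sub>0 'b"
  by (simp add: scaleR_poly_mapping_def Poly_Mapping.map.rep_eq when_def)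

instance
  by standard
    (rule poly_mapping_eqI; simp add: lookup_scaleR lookup_add scaleR_add_right scaleR_add_left)+

end

definition free_lift :: "('k \<Rightarrow> 'b::real_vector) \<Rightarrow> ('k \<Rightarrow>\<^sub>0 real) \<Rightarrow> 'b"
  where "free_lift f p = (\<Sum>k\<in>Poly_Mapping.keys p. Poly_Mapping.lookup p k *\<^sub>R f k)"

lemma free_lift_superset:
  "finite K \<Longrightarrow> Poly_Mapping.keys p \<subseteq> K \<Longrightarrow> free_lift f p = (\<Sum>k\<in>K. Poly_Mapping.lookup p k *\<^sub>R f k)"
  unfolding free_lift_def
  by (rule sum.mono_neutral_left) (auto simp: in_keys_iff)

lemma linear_free_lift: "linear (free_lift f)"
proof (rule linearI)
  fix p q :: "'a \<Rightarrow>\<^sub>0 real" and c :: real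
  let ?K = "Poly_Mapping.keys p \<union> Poly_Mapping.keys q"
  have "Poly_Mapping.keys (p + q) \<subseteq> ?K" by (rule keys_add)
  then show "free_lift f (p + q) = free_lift f p + free_lift f q"
    by (simp add: free_lift_superset[of ?K] lookup_add scaleR_add_left sum.distrib)
  have "Poly_Mapping.keys (c *\<^sub>R p) \<subseteq> Poly_Mapping.keys p" by (auto simp: in_keys_iff lookup_scaleR)
  then show "free_lift f (c *\<^sub>R p) = c *\<^sub>R free_lift f p"
    by (simp add: free_lift_superset[of "Poly_Mapping.keys p"] lookup_scaleR scaleR_sum_right)
qed

lemma free_lift_single [simp]: "free_lift f (Poly_Mapping.single k c) = c *\<^sub>R f k"
  by (cases "c = 0") (simp_all add: free_lift_def)

lemma free_expansion: "free_lift (\<lambda>k. Poly_Mapping.single k (1::real)) p = p"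
proof (rule poly_mapping_eqI)
  fix k
  have "(\<Sum>j\<in>Poly_Mapping.keys p. Poly_Mapping.lookup p j * (1 when j = k)) = Poly_Mapping.lookup p k"
    by (cases "k \<in> Poly_Mapping.keys p")
      (auto simp: when_def in_keys_iff if_distrib[of "times _"] cong: if_cong)
  then show "Poly_Mapping.lookup (free_lift (\<lambda>k. Poly_Mapping.single k (1::real)) p) k = Poly_Mapping.lookup p k"
    by (simp add: free_lift_def lookup_sum lookup_scaleR lookup_single)
qed

lemma free_span: "p \<in> span (range (\<lambda>k. Poly_Mapping.single k (1::real)))"
  by (subst free_expansion[symmetric], unfold free_lift_def)
    (blast intro: span_sum span_scale span_base)

lemma equivp_mod_span: "equivp (\<lambda>x y. x - y \<in> span S)"
proof (rule equivpI)
  show "reflp (\<lambda>x y. x - y \<in> span S)" by (simp add: reflp_def span_zero)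
  show "symp (\<lambda>x y. x - y \<in> span S)"
  proof (rule sympI)
    fix x y assume "x - y \<in> span S"
    then have "- (x - y) \<in> span S" by (rule span_neg)
    then show "y - x \<in> span S" by simp
  qed
  show "transp (\<lambda>x y. x - y \<in> span S)"
  proof (rule transpI)
    fix x y z assume "x - y \<in> span S" "y - z \<in> span S"
    then have "(x - y) + (y - z) \<in> span S" by (rule span_add)
    then show "x - z \<in> span S" by simp
  qed
qed

lemma rep_abs_mod_span:
  "Quotient (\<lambda>x y. x - y \<in> span S) Abs Rep cr \<Longrightarrow> Rep (Abs p) - p \<in> span S"
  by (erule Quotient_rep_abs) (simp add: span_zero)

lemma mod_span_add:
  "a - b \<in> span S \<Longrightarrow> c - d \<in> span S \<Longrightarrow> (a + c) - (b + d) \<in> span S"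
  using span_add[of "a - b" S "c - d"] by (simp add: algebra_simps)

lemma mod_span_uminus: "a - b \<in> span S \<Longrightarrow> - a - - b \<in> span S"
  using span_neg[of "a - b" S] by simp

lemma mod_span_diff:
  "a - b \<in> span S \<Longrightarrow> c - d \<in> span S \<Longrightarrow> (a - c) - (b - d) \<in> span S"
  using span_diff[of "a - b" S "c - d"] by (simp add: algebra_simps)

lemma mod_span_scaleR: "a - b \<in> span S \<Longrightarrow> c *\<^sub>R a - c *\<^sub>R b \<in> span S"
  using span_scale[of "a - b" S c] by (simp add: scaleR_diff_right)

definition multilinear :: "('a::real_vector list \<Rightarrow> 'b::real_vector) \<Rightarrow> bool"
  where "multilinear f \<longleftrightarrow> (\<forall>xs ys. linear (\<lambda>x. f (xs @ x # ys)))"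

definition multilinear_relations :: "('a::real_vector list \<Rightarrow>\<^sub>0 real) set" where
  "multilinear_relations =
     {Poly_Mapping.single (xs @ (x + y) # ys) 1
        - Poly_Mapping.single (xs @ x # ys) 1 - Poly_Mapping.single (xs @ y # ys) 1
      | xs x y ys. True} \<union>
     {Poly_Mapping.single (xs @ (c *\<^sub>R x) # ys) 1 - c *\<^sub>R Poly_Mapping.single (xs @ x # ys) 1
      | xs c x ys. True}"

text \<open>The tensor algebra \<open>T(V)\<close> is the free vector space on all lists of vectors
  modulo multilinearity in each entry; the list \<open>[v\<^sub>1, \<dots>, v\<^sub>n]\<close> stands for
  \<open>v\<^sub>1 \<otimes> \<dots> \<otimes> v\<^sub>n\<close>, and \<open>V\<^sup>\<otimes>\<^sup>n\<close> is the span of the lists of length \<open>n\<close>.\<close>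

quotient_type (overloaded) 'a tensor =
    "'a::real_vector list \<Rightarrow>\<^sub>0 real" / "\<lambda>p q. p - q \<in> span multilinear_relations"
  by (rule equivp_mod_span)

instantiation tensor :: (real_vector) real_vector
begin
lift_definition zero_tensor :: "'a tensor" is 0 .
lift_definition plus_tensor :: "'a tensor \<Rightarrow> 'a tensor \<Rightarrow> 'a tensor" is "(+)"
  by (rule mod_span_add)
lift_definition minus_tensor :: "'a tensor \<Rightarrow> 'a tensor \<Rightarrow> 'a tensor" is "(-)"
  by (rule mod_span_diff)
lift_definition uminus_tensor :: "'a tensor \<Rightarrow> 'a tensor" is "uminus"
  by (rule mod_span_uminus)
lift_definition scaleR_tensor :: "real \<Rightarrow> 'a tensor \<Rightarrow> 'a tensor" is "scaleR"
  by (rule mod_span_scaleR)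
instance
  by standard (transfer, simp add: algebra_simps span_zero)+
end

lift_definition tensor_of :: "'a::real_vector list \<Rightarrow> 'a tensor"
  is "\<lambda>xs. Poly_Mapping.single xs 1" .

definition tensor_power :: "nat \<Rightarrow> 'a::real_vector tensor set"
  where "tensor_power n = span (tensor_of ` {xs. length xs = n})"

text \<open>The linear map on \<open>T(V)\<close> determined by a multilinear \<open>f\<close>. It is meaningful only for
  multilinear \<open>f\<close>, when the choice of representative is immaterial.\<close>

definition tensor_lift :: "('a::real_vector list \<Rightarrow> 'b::real_vector) \<Rightarrow> 'a tensor \<Rightarrow> 'b"
  where "tensor_lift f t = free_lift f (rep_tensor t)"

lemma linear_eq_mod_span:
  assumes "linear g" "\<And>r. r \<in> S \<Longrightarrow> g r = 0" "p - q \<in> span S"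
  shows "g p = g q"
proof -
  have "g (p - q) = 0" by (rule linear_eq_0_on_span[OF assms(1) _ assms(3)]) (rule assms(2))
  then show ?thesis by (simp add: linear_diff[OF assms(1)])
qed

lemma free_lift_relations:
  assumes "multilinear f" "r \<in> multilinear_relations" shows "free_lift f r = 0"
proof -
  have L: "linear (\<lambda>x. f (xs @ x # ys))" for xs ys
    using assms(1) by (simp add: multilinear_def)
  note lin = linear_diff[OF linear_free_lift] linear_scale[OF linear_free_lift] free_lift_single
  consider (add) xs x y ys where "r = Poly_Mapping.single (xs @ (x + y) # ys) 1
        - Poly_Mapping.single (xs @ x # ys) 1 - Poly_Mapping.single (xs @ y # ys) 1"
    | (scale) xs c x ys where "r = Poly_Mapping.single (xs @ (c *\<^sub>R x) # ys) 1
        - c *\<^sub>R Poly_Mapping.single (xs @ x # ys) 1"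
    using assms(2) unfolding multilinear_relations_def by blast
  then show ?thesis
  proof cases
    case add
    show ?thesis unfolding add lin using linear_add[OF L, of xs x y ys] by simp
  next
    case scale
    show ?thesis unfolding scale lin using linear_scale[OF L, of xs c x ys] by simp
  qed
qed

lemma tensor_lift_abs:
  assumes "multilinear f" shows "tensor_lift f (abs_tensor p) = free_lift f p"
  unfolding tensor_lift_def
  by (rule linear_eq_mod_span[OF linear_free_lift free_lift_relations[OF assms]
        rep_abs_mod_span[OF Quotient_tensor]])

lemma abs_rep_tensor: "abs_tensor (rep_tensor t) = t"
  by (rule Quotient_abs_rep[OF Quotient_tensor])

lemma linear_abs_tensor: "linear abs_tensor"
  by (rule linearI) (simp_all add: plus_tensor.abs_eq scaleR_tensor.abs_eq)

lemma linear_tensor_lift: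
  assumes "multilinear f" shows "linear (tensor_lift f)"
proof (rule linearI)
  fix s t :: "'a tensor" and c :: real
  obtain p q where "s = abs_tensor p" "t = abs_tensor q"
    by (metis abs_rep_tensor)
  then show "tensor_lift f (s + t) = tensor_lift f s + tensor_lift f t"
    "tensor_lift f (c *\<^sub>R s) = c *\<^sub>R tensor_lift f s"
    by (simp_all add: plus_tensor.abs_eq scaleR_tensor.abs_eq tensor_lift_abs[OF assms]
        linear_add[OF linear_free_lift] linear_scale[OF linear_free_lift])
qed

lemma tensor_lift_tensor_of:
  "multilinear f \<Longrightarrow> tensor_lift f (tensor_of xs) = f xs"
  by (simp add: tensor_of.abs_eq tensor_lift_abs)

lemma tensor_span: "t \<in> span (range tensor_of)"
proof -
  have "abs_tensor ` span (range (\<lambda>k::'a list. Poly_Mapping.single k 1)) = span (range tensor_of)"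
    by (subst linear_span_image[OF linear_abs_tensor, symmetric])
      (simp add: image_image tensor_of.abs_eq)
  moreover have "abs_tensor (rep_tensor t) \<in> abs_tensor ` span (range (\<lambda>k. Poly_Mapping.single k 1))"
    by (rule imageI) (rule free_span)
  ultimately show ?thesis by (simp add: abs_rep_tensor)
qed

lemma tensor_linear_eqI:
  assumes "linear f" "linear g" "\<And>xs. f (tensor_of xs) = g (tensor_of xs)"
  shows "f t = g t"
  by (rule linear_eq_on_span[OF assms(1,2) _ tensor_span]) (auto simp: assms(3))

lemma multilinear_tensor_of: "multilinear tensor_of"
  unfolding multilinear_def
proof (intro allI linearI)
  fix xs ys :: "'a list" and x y :: 'a and c :: real
  let ?s = "\<lambda>zs. Poly_Mapping.single zs (1::real)"
  have "?s (xs @ (x + y) # ys) - ?s (xs @ x # ys) - ?s (xs @ y # ys) \<in> span multilinear_relations"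
    by (rule span_base, unfold multilinear_relations_def) blast
  then show "tensor_of (xs @ (x + y) # ys) = tensor_of (xs @ x # ys) + tensor_of (xs @ y # ys)"
    by (simp add: tensor_of.abs_eq plus_tensor.abs_eq tensor.abs_eq_iff diff_diff_add)
  have "?s (xs @ (c *\<^sub>R x) # ys) - c *\<^sub>R ?s (xs @ x # ys) \<in> span multilinear_relations"
    by (rule span_base, unfold multilinear_relations_def) blast
  then show "tensor_of (xs @ (c *\<^sub>R x) # ys) = c *\<^sub>R tensor_of (xs @ x # ys)"
    by (simp add: tensor_of.abs_eq scaleR_tensor.abs_eq tensor.abs_eq_iff)
qed

lemma multilinear_append:
  assumes "multilinear f"
  shows "multilinear (\<lambda>xs. f (xs @ ys))" "multilinear (\<lambda>ys. f (xs @ ys))"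
proof -
  have L: "linear (\<lambda>x. f (us @ x # vs))" for us vs
    using assms by (simp add: multilinear_def)
  show "multilinear (\<lambda>xs. f (xs @ ys))"
    unfolding multilinear_def using L[of _ "_ @ ys"] by simp
  show "multilinear (\<lambda>ys. f (xs @ ys))"
    unfolding multilinear_def using L[of "xs @ _"] by simp
qed

instantiation tensor :: (real_vector) real_algebra_1
begin

definition one_tensor :: "'a tensor" where "one_tensor = tensor_of []"

definition times_tensor :: "'a tensor \<Rightarrow> 'a tensor \<Rightarrow> 'a tensor" where
  "times_tensor s t = tensor_lift (\<lambda>xs. tensor_lift (\<lambda>ys. tensor_of (xs @ ys)) t) s"

lemma linear_times_right: "linear (\<lambda>t. s * t)" for s :: "'a tensor"
proof -
  have L: "linear (\<lambda>t. tensor_lift (\<lambda>ys. tensor_of (xs @ ys)) t)" for xs :: "'a list"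
    by (rule linear_tensor_lift) (rule multilinear_append(2)[OF multilinear_tensor_of])
  show ?thesis
    unfolding times_tensor_def tensor_lift_def[of _ s] free_lift_def
    by (intro linear_compose_sum ballI linear_compose_scale_right L)
qed

lemma linear_tensor_of_append:
  "linear (\<lambda>x. tensor_lift (\<lambda>zs. tensor_of ((xs @ x # ys) @ zs)) t)" for t :: "'a tensor"
proof -
  have "linear (\<lambda>x. tensor_of ((xs @ x # ys) @ zs))" for zs
    using multilinear_append(1)[OF multilinear_tensor_of, of zs] by (simp add: multilinear_def)
  then show ?thesis
    unfolding tensor_lift_def free_lift_def
    by (intro linear_compose_sum ballI linear_compose_scale_right)
qed

lemma linear_times_left: "linear (\<lambda>s. s * t)" for t :: "'a tensor"
  unfolding times_tensor_def
  by (rule linear_tensor_lift) (unfold multilinear_def, intro allI linear_tensor_of_append)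

lemma times_tensor_of: "tensor_of xs * tensor_of ys = tensor_of (xs @ ys)"
proof -
  have L: "linear (\<lambda>x. tensor_lift (\<lambda>zs. tensor_of ((us @ x # vs) @ zs)) t)"
    for us vs and t :: "'a tensor"
    by (rule linear_tensor_of_append)
  have "tensor_of xs * t = tensor_lift (\<lambda>ys. tensor_of (xs @ ys)) t" for t :: "'a tensor"
    unfolding times_tensor_def
    by (rule tensor_lift_tensor_of[of "\<lambda>xs. tensor_lift (\<lambda>ys. tensor_of (xs @ ys)) t"])
      (use L in \<open>simp add: multilinear_def\<close>)
  then show ?thesis
    by (simp add: tensor_lift_tensor_of multilinear_append(2)[OF multilinear_tensor_of])
qed

instance
proof
  fix a b c :: "'a tensor" and r :: real
  show "(a + b) * c = a * c + b * c" by (rule linear_add[OF linear_times_left])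
  show "a * (b + c) = a * b + a * c" by (rule linear_add[OF linear_times_right])
  show "(r *\<^sub>R a) * b = r *\<^sub>R (a * b)" by (rule linear_scale[OF linear_times_left])
  show "a * (r *\<^sub>R b) = r *\<^sub>R (a * b)" by (rule linear_scale[OF linear_times_right])
  show "1 * a = a"
    by (rule tensor_linear_eqI[OF linear_times_right linear_ident])
      (simp add: one_tensor_def times_tensor_of)
  show "a * 1 = a"
    by (rule tensor_linear_eqI[OF linear_times_left linear_ident])
      (simp add: one_tensor_def times_tensor_of)
  have L: "linear (\<lambda>u. f (g u))" if "linear f" "linear g" for f g :: "'a tensor \<Rightarrow> 'a tensor"
    using linear_compose[OF that(2,1)] by (simp add: o_def)
  show "(a * b) * c = a * (b * c)"
  proof (rule tensor_linear_eqI[of "\<lambda>a. (a * b) * c" "\<lambda>a. a * (b * c)"])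
    show "linear (\<lambda>a. (a * b) * c)" by (rule L[OF linear_times_left linear_times_left])
    show "linear (\<lambda>a. a * (b * c))" by (rule linear_times_left)
    fix xs
    show "(tensor_of xs * b) * c = tensor_of xs * (b * c)"
    proof (rule tensor_linear_eqI[of "\<lambda>b. (tensor_of xs * b) * c" "\<lambda>b. tensor_of xs * (b * c)"])
      show "linear (\<lambda>b. (tensor_of xs * b) * c)" by (rule L[OF linear_times_left linear_times_right])
      show "linear (\<lambda>b. tensor_of xs * (b * c))" by (rule L[OF linear_times_right linear_times_left])
      fix ys
      show "(tensor_of xs * tensor_of ys) * c = tensor_of xs * (tensor_of ys * c)"
        by (rule tensor_linear_eqI[OF linear_times_right L[OF linear_times_right linear_times_right]])
          (simp add: times_tensor_of)
    qed
  qed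
  show "(0::'a tensor) \<noteq> 1"
  proof
    let ?f = "\<lambda>xs::'a list. if xs = [] then 1 else 0::real"
    assume "(0::'a tensor) = 1"
    moreover have f: "multilinear ?f" by (simp add: multilinear_def module_hom_zero)
    then have "tensor_lift ?f 1 = 1" "tensor_lift ?f 0 = 0"
      by (simp_all add: one_tensor_def tensor_lift_tensor_of linear_0[OF linear_tensor_lift])
    ultimately show False by simp
  qed
qed

end


section \<open>Exterior algebra\<close>

definition multiples :: "'a::ring_1 set \<Rightarrow> 'a set"
  where "multiples R = {a * r * b | a r b. r \<in> R}"

text \<open>\<open>span (multiples R)\<close> is the two-sided ideal generated by \<open>R\<close>.\<close>

definition alternating_relations :: "'a::real_vector tensor set"
  where "alternating_relations = range (\<lambda>x. tensor_of [x, x])"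

quotient_type (overloaded) 'a exterior =
    "'a::real_vector tensor" / "\<lambda>s t. s - t \<in> span (multiples alternating_relations)"
  by (rule equivp_mod_span)

instantiation exterior :: (real_vector) real_vector
begin
lift_definition zero_exterior :: "'a exterior" is 0 .
lift_definition plus_exterior :: "'a exterior \<Rightarrow> 'a exterior \<Rightarrow> 'a exterior" is "(+)"
  by (rule mod_span_add)
lift_definition minus_exterior :: "'a exterior \<Rightarrow> 'a exterior \<Rightarrow> 'a exterior" is "(-)"
  by (rule mod_span_diff)
lift_definition uminus_exterior :: "'a exterior \<Rightarrow> 'a exterior" is "uminus"
  by (rule mod_span_uminus)
lift_definition scaleR_exterior :: "real \<Rightarrow> 'a exterior \<Rightarrow> 'a exterior" is "scaleR"
  by (rule mod_span_scaleR)
instance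
  by standard (transfer, simp add: algebra_simps span_zero)+
end

definition wedge :: "'a::real_vector list \<Rightarrow> 'a exterior"
  where "wedge xs = abs_exterior (tensor_of xs)"

definition exterior_power :: "nat \<Rightarrow> 'a::real_vector exterior set"
  where "exterior_power n = abs_exterior ` tensor_power n"

definition alternating :: "('a::real_vector list \<Rightarrow> 'b::real_vector) \<Rightarrow> bool"
  where "alternating f \<longleftrightarrow> multilinear f \<and> (\<forall>xs x ys. f (xs @ x # x # ys) = 0)"

text \<open>As for \<open>tensor_lift\<close>, this is meaningful only for alternating \<open>f\<close>.\<close>

definition exterior_lift :: "('a::real_vector list \<Rightarrow> 'b::real_vector) \<Rightarrow> 'a exterior \<Rightarrow> 'b"
  where "exterior_lift f w = tensor_lift f (rep_exterior w)"

lemma linear_abs_exterior: "linear abs_exterior"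
  by (rule linearI) (simp_all add: plus_exterior.abs_eq scaleR_exterior.abs_eq)

lemma abs_rep_exterior: "abs_exterior (rep_exterior w) = w"
  by (rule Quotient_abs_rep[OF Quotient_exterior])

lemma tensor_lift_alternating_multiples:
  assumes "alternating f" "r \<in> multiples alternating_relations"
  shows "tensor_lift f r = 0"
proof -
  have f: "multilinear f" and alt: "f (xs @ x # x # ys) = 0" for xs x ys
    using assms(1) by (simp_all add: alternating_def)
  obtain a x b where r: "r = a * tensor_of [x, x] * b"
    using assms(2) by (auto simp: multiples_def alternating_relations_def)
  note lin = linear_tensor_lift[OF f]
  have *: "tensor_lift f (tensor_of xs * tensor_of [x, x] * b) = 0" for xs
  proof (rule tensor_linear_eqI[of "\<lambda>b. tensor_lift f (tensor_of xs * tensor_of [x, x] * b)" "\<lambda>_. 0"])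
    show "linear (\<lambda>b. tensor_lift f (tensor_of xs * tensor_of [x, x] * b))"
      using linear_compose[OF linear_times_right lin] by (simp add: o_def)
  qed (simp_all add: module_hom_zero times_tensor_of tensor_lift_tensor_of[OF f] alt)
  have "tensor_lift f (a * tensor_of [x, x] * b) = 0"
  proof (rule tensor_linear_eqI[of "\<lambda>a. tensor_lift f (a * tensor_of [x, x] * b)" "\<lambda>_. 0"])
    show "linear (\<lambda>a. tensor_lift f (a * tensor_of [x, x] * b))"
      using linear_compose[OF linear_compose[OF linear_times_left linear_times_left] lin]
      by (simp add: o_def)
  qed (simp_all add: module_hom_zero *)
  then show ?thesis by (simp add: r)
qed

lemma exterior_lift_abs:
  assumes "alternating f" shows "exterior_lift f (abs_exterior t) = tensor_lift f t"
proof -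
  have "multilinear f" using assms by (simp add: alternating_def)
  then show ?thesis
    unfolding exterior_lift_def
    by (rule linear_eq_mod_span[OF linear_tensor_lift
          tensor_lift_alternating_multiples[OF assms] rep_abs_mod_span[OF Quotient_exterior]])
qed

lemma exterior_lift_wedge: "alternating f \<Longrightarrow> exterior_lift f (wedge xs) = f xs"
  by (simp add: wedge_def exterior_lift_abs tensor_lift_tensor_of alternating_def)

section \<open>Cyclic quotient\<close>

text \<open>\<open>t(a\<^sub>0, \<dots>, a\<^sub>n) = (-1)\<^sup>n (a\<^sub>n, a\<^sub>0, \<dots>, a\<^bsub>n-1\<^esub>)\<close>; here \<open>rotate n\<close> rotates \<open>n\<close> steps to the
  left, which is one step to the right on a list of length \<open>n + 1\<close>.\<close>

definition cyclic_operator :: "'a::real_vector tensor \<Rightarrow> 'a tensor" where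
  "cyclic_operator =
     tensor_lift (\<lambda>as. (-1) ^ (length as - 1) *\<^sub>R tensor_of (rotate (length as - 1) as))"

text \<open>All degrees are divided out at once; since the cyclic operator preserves degree, the image
  of \<open>V\<^sup>\<otimes>\<^sup>n\<^sup>+\<^sup>1\<close> in this quotient is \<open>V\<^sup>\<otimes>\<^sup>n\<^sup>+\<^sup>1 / Im(1 - t)\<close>.\<close>

quotient_type (overloaded) 'a cyclic_tensor =
    "'a::real_vector tensor" / "\<lambda>s t. s - t \<in> span (range (\<lambda>w. w - cyclic_operator w))"
  by (rule equivp_mod_span)

instantiation cyclic_tensor :: (real_vector) real_vector
begin
lift_definition zero_cyclic_tensor :: "'a cyclic_tensor" is 0 .
lift_definition plus_cyclic_tensor :: "'a cyclic_tensor \<Rightarrow> 'a cyclic_tensor \<Rightarrow> 'a cyclic_tensor" is "(+)"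
  by (rule mod_span_add)
lift_definition minus_cyclic_tensor :: "'a cyclic_tensor \<Rightarrow> 'a cyclic_tensor \<Rightarrow> 'a cyclic_tensor" is "(-)"
  by (rule mod_span_diff)
lift_definition uminus_cyclic_tensor :: "'a cyclic_tensor \<Rightarrow> 'a cyclic_tensor" is "uminus"
  by (rule mod_span_uminus)
lift_definition scaleR_cyclic_tensor :: "real \<Rightarrow> 'a cyclic_tensor \<Rightarrow> 'a cyclic_tensor" is "scaleR"
  by (rule mod_span_scaleR)
instance
  by standard (transfer, simp add: algebra_simps span_zero)+
end

section \<open>Lie algebras and the universal enveloping algebra\<close>

class lie_algebra = real_vector +
  fixes lie_bracket :: "'a \<Rightarrow> 'a \<Rightarrow> 'a"
  assumes lie_bracket_add_left: "lie_bracket (x + y) z = lie_bracket x z + lie_bracket y z"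
    and lie_bracket_add_right: "lie_bracket x (y + z) = lie_bracket x y + lie_bracket x z"
    and lie_bracket_scaleR_left: "lie_bracket (c *\<^sub>R x) y = c *\<^sub>R lie_bracket x y"
    and lie_bracket_scaleR_right: "lie_bracket x (c *\<^sub>R y) = c *\<^sub>R lie_bracket x y"
    and lie_bracket_self: "lie_bracket x x = 0"
    and jacobi: "lie_bracket x (lie_bracket y z) + lie_bracket y (lie_bracket z x)
                   + lie_bracket z (lie_bracket x y) = 0"

definition enveloping_relations :: "'a::lie_algebra tensor set" where
  "enveloping_relations =
     {tensor_of [x, y] - tensor_of [y, x] - tensor_of [lie_bracket x y] | x y. True}"

quotient_type (overloaded) 'a uea =
    "'a::lie_algebra tensor" / "\<lambda>s t. s - t \<in> span (multiples enveloping_relations)"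
  by (rule equivp_mod_span)

instantiation uea :: (lie_algebra) real_vector
begin
lift_definition zero_uea :: "'a uea" is 0 .
lift_definition plus_uea :: "'a uea \<Rightarrow> 'a uea \<Rightarrow> 'a uea" is "(+)"
  by (rule mod_span_add)
lift_definition minus_uea :: "'a uea \<Rightarrow> 'a uea \<Rightarrow> 'a uea" is "(-)"
  by (rule mod_span_diff)
lift_definition uminus_uea :: "'a uea \<Rightarrow> 'a uea" is "uminus"
  by (rule mod_span_uminus)
lift_definition scaleR_uea :: "real \<Rightarrow> 'a uea \<Rightarrow> 'a uea" is "scaleR"
  by (rule mod_span_scaleR)
instance
  by standard (transfer, simp add: algebra_simps span_zero)+
end

lemma multiplesI: "r \<in> R \<Longrightarrow> a * r * b \<in> multiples R"
  unfolding multiples_def by blast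

lemma multiplesE:
  assumes "x \<in> multiples R"
  obtains a r b where "x = a * r * b" "r \<in> R"
  using assms unfolding multiples_def by blast

lemma multiples_mult:
  assumes "x \<in> multiples R" shows "c * x \<in> multiples R" "x * c \<in> multiples R"
proof -
  obtain a r b where x: "x = a * r * b" "r \<in> R" using assms by (rule multiplesE)
  show "c * x \<in> multiples R"
    using multiplesI[OF x(2), of "c * a" b] by (simp add: x(1) mult.assoc)
  show "x * c \<in> multiples R"
    using multiplesI[OF x(2), of a "b * c"] by (simp add: x(1) mult.assoc)
qed

lemma span_multiples_mult:
  fixes r c :: "'a::real_algebra_1"
  assumes "r \<in> span (multiples R)"
  shows "c * r \<in> span (multiples R)" "r * c \<in> span (multiples R)"
proof -
  have "subspace {x. c * x \<in> span (multiples R)}" "subspace {x. x * c \<in> span (multiples R)}"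
    by (simp_all add: subspace_def span_zero span_add span_scale distrib_left distrib_right)
  then show "c * r \<in> span (multiples R)" "r * c \<in> span (multiples R)"
    using span_induct[OF assms, of "\<lambda>x. c * x \<in> span (multiples R)"]
      span_induct[OF assms, of "\<lambda>x. x * c \<in> span (multiples R)"]
    by (simp_all add: span_base multiples_mult)
qed

lemma one_notin_enveloping_ideal: "1 \<notin> span (multiples enveloping_relations)"
proof
  let ?f = "\<lambda>xs::'a list. if xs = [] then 1 else 0::real"
  let ?e = "tensor_lift ?f"
  have f: "multilinear ?f" by (simp add: multilinear_def module_hom_zero)
  note lin = linear_tensor_lift[OF f]
  have gen: "?e (tensor_of xs * tensor_of (x # ys) * b) = 0" for xs x ys b
  proof (rule tensor_linear_eqI[of "\<lambda>b. ?e (tensor_of xs * tensor_of (x # ys) * b)" "\<lambda>_. 0"])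
    show "linear (\<lambda>b. ?e (tensor_of xs * tensor_of (x # ys) * b))"
      using linear_compose[OF linear_times_right lin] by (simp add: o_def)
  qed (simp_all add: module_hom_zero times_tensor_of tensor_lift_tensor_of[OF f])
  have gen': "?e (a * tensor_of (x # ys) * b) = 0" for a x ys b
  proof (rule tensor_linear_eqI[of "\<lambda>a. ?e (a * tensor_of (x # ys) * b)" "\<lambda>_. 0"])
    show "linear (\<lambda>a. ?e (a * tensor_of (x # ys) * b))"
      using linear_compose[OF linear_compose[OF linear_times_left linear_times_left] lin]
      by (simp add: o_def)
  qed (simp_all add: module_hom_zero gen)
  have "?e r = 0" if r: "r \<in> multiples enveloping_relations" for r
  proof -
    obtain a q b where q: "r = a * q * b" "q \<in> enveloping_relations"
      using r by (rule multiplesE)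
    obtain x y where "q = tensor_of [x, y] - tensor_of [y, x] - tensor_of [lie_bracket x y]"
      using q(2) unfolding enveloping_relations_def by auto
    then show ?thesis
      by (simp only: q(1) left_diff_distrib right_diff_distrib linear_diff[OF lin] gen' diff_self)
  qed
  moreover assume "1 \<in> span (multiples (enveloping_relations :: 'a tensor set))"
  ultimately have "?e 1 = 0" by (rule linear_eq_0_on_span[OF lin])
  then show False by (simp add: one_tensor_def tensor_lift_tensor_of[OF f])
qed

instantiation uea :: (lie_algebra) real_algebra_1
begin
lift_definition one_uea :: "'a uea" is 1 .
lift_definition times_uea :: "'a uea \<Rightarrow> 'a uea \<Rightarrow> 'a uea" is "(*)"
proof -
  fix a b c d :: "'a tensor"
  let ?I = "span (multiples enveloping_relations) :: 'a tensor set"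
  assume "a - b \<in> ?I" "c - d \<in> ?I"
  then have "a * (c - d) + (a - b) * d \<in> ?I"
    by (intro span_add span_multiples_mult)
  then show "a * c - b * d \<in> ?I" by (simp add: algebra_simps)
qed
instance
proof
  show "(0::'a uea) \<noteq> 1"
  proof
    assume "(0::'a uea) = 1"
    then have "0 - 1 \<in> span (multiples (enveloping_relations :: 'a tensor set))"
      by (simp only: zero_uea_def one_uea_def uea.abs_eq_iff)
    from span_neg[OF this] show False by (simp add: one_notin_enveloping_ideal)
  qed
  fix a b c :: "'a uea" and r :: real
  show "(a * b) * c = a * (b * c)"
    by transfer (simp add: mult.assoc span_zero)
  show "(a + b) * c = a * c + b * c"
    by transfer (simp add: distrib_right span_zero)
  show "a * (b + c) = a * b + a * c"
    by transfer (simp add: distrib_left span_zero)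
  show "1 * a = a" "a * 1 = a"
    by (transfer, simp add: span_zero)+
  show "(r *\<^sub>R a) * b = r *\<^sub>R (a * b)" "a * (r *\<^sub>R b) = r *\<^sub>R (a * b)"
    by (transfer, simp add: span_zero)+
qed
end

definition uea_inclusion :: "'a::lie_algebra \<Rightarrow> 'a uea"
  where "uea_inclusion x = abs_uea (tensor_of [x])"

definition commutator :: "'a::ring \<Rightarrow> 'a \<Rightarrow> 'a"
  where "commutator a b = a * b - b * a"

section \<open>Polynomial vector fields on the line\<close>

text \<open>\<open>vector_field p\<close> is \<open>p d/dx\<close>.\<close>

typedef poly_vector_field = "UNIV :: real poly set"
  morphisms coefficient vector_field by simp

setup_lifting type_definition_poly_vector_field

instantiation poly_vector_field :: lie_algebra
begin
lift_definition zero_poly_vector_field :: poly_vector_field is 0 .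
lift_definition plus_poly_vector_field ::
  "poly_vector_field \<Rightarrow> poly_vector_field \<Rightarrow> poly_vector_field" is "(+)" .
lift_definition minus_poly_vector_field ::
  "poly_vector_field \<Rightarrow> poly_vector_field \<Rightarrow> poly_vector_field" is "(-)" .
lift_definition uminus_poly_vector_field :: "poly_vector_field \<Rightarrow> poly_vector_field" is uminus .
lift_definition scaleR_poly_vector_field ::
  "real \<Rightarrow> poly_vector_field \<Rightarrow> poly_vector_field" is smult .
lift_definition lie_bracket_poly_vector_field ::
  "poly_vector_field \<Rightarrow> poly_vector_field \<Rightarrow> poly_vector_field"
  is "\<lambda>p q. p * pderiv q - q * pderiv p" .
instance
  by standard
    (transfer, simp add: pderiv_add pderiv_diff pderiv_mult pderiv_smult algebra_simps
      smult_add_left smult_add_right smult_diff_right)+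
end

lemma lie_bracket_monomials:
  "lie_bracket (vector_field (monom 1 n)) (vector_field (monom 1 k))
     = (real k - real n) *\<^sub>R vector_field (monom 1 (n + k - 1))"
proof -
  have "monom 1 n * pderiv (monom 1 k) = monom (real k) (n + k - 1)" for n k
    by (cases k) (simp_all add: pderiv_monom mult_monom)
  then show ?thesis
    by (simp add: lie_bracket_poly_vector_field.abs_eq scaleR_poly_vector_field.abs_eq
        eq_onp_same_args smult_monom diff_monom add.commute)
qed

definition e_field :: "int \<Rightarrow> poly_vector_field"
  where "e_field i = vector_field (monom 1 (nat (i + 1)))"

section \<open>Homology\<close>

text \<open>A chain complex is given by the subspaces of \<open>n\<close>-chains inside one ambient space and a
  boundary operator on that space.\<close>

record 'v chain_cx =
  chains :: "nat \<Rightarrow> 'v set"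
  boundary :: "'v \<Rightarrow> 'v"

definition cycle_group :: "'v::real_vector chain_cx \<Rightarrow> nat \<Rightarrow> 'v monoid" where
  "cycle_group K n =
     \<lparr>carrier = {z \<in> chains K n. boundary K z = 0}, monoid.mult = (+), one = 0\<rparr>"

definition boundaries :: "'v::real_vector chain_cx \<Rightarrow> nat \<Rightarrow> 'v set"
  where "boundaries K n = boundary K ` chains K (Suc n)"

definition homology :: "'v::real_vector chain_cx \<Rightarrow> nat \<Rightarrow> 'v set monoid"
  where "homology K n = cycle_group K n Mod boundaries K n"

definition homology_class :: "'v::real_vector chain_cx \<Rightarrow> nat \<Rightarrow> 'v \<Rightarrow> 'v set"
  where "homology_class K n z = boundaries K n #>\<^bsub>cycle_group K n\<^esub> z"

text \<open>The map into \<open>H\<^sub>n(L)\<close> sending the class of a cycle \<open>z\<close> to the class of \<open>f z\<close>.\<close>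

definition induced_map ::
  "'w::real_vector chain_cx \<Rightarrow> nat \<Rightarrow> ('v \<Rightarrow> 'w) \<Rightarrow> 'v set \<Rightarrow> 'w set"
  where "induced_map L n f c = the_elem ((\<lambda>z. homology_class L n (f z)) ` c)"

section \<open>The four complexes\<close>

text \<open>List positions start at \<open>0\<close>, so the sign attached to the pair of positions \<open>i < j\<close> is
  \<open>(-1) ^ (j + 1)\<close>.\<close>

definition bracket_entries :: "('a \<Rightarrow> 'a \<Rightarrow> 'a) \<Rightarrow> nat \<Rightarrow> nat \<Rightarrow> 'a list \<Rightarrow> 'a list" where
  "bracket_entries br i j gs =
     (let hs = gs[i := br (gs ! i) (gs ! j)] in take j hs @ drop (Suc j) hs)"

definition leibniz_complex :: "('a::real_vector \<Rightarrow> 'a \<Rightarrow> 'a) \<Rightarrow> 'a tensor chain_cx" where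
  "leibniz_complex br = \<lparr>chains = tensor_power,
     boundary = tensor_lift (\<lambda>gs. \<Sum>j<length gs. \<Sum>i<j.
       (-1) ^ (j + 1) *\<^sub>R tensor_of (bracket_entries br i j gs))\<rparr>"

definition lie_complex :: "('a::real_vector \<Rightarrow> 'a \<Rightarrow> 'a) \<Rightarrow> 'a exterior chain_cx" where
  "lie_complex br = \<lparr>chains = exterior_power,
     boundary = exterior_lift (\<lambda>gs. \<Sum>j<length gs. \<Sum>i<j.
       (-1) ^ (j + 1) *\<^sub>R wedge (bracket_entries br i j gs))\<rparr>"

text \<open>Below, \<open>as = [a\<^sub>0, \<dots>, a\<^sub>n]\<close> with \<open>n = length as - 1\<close>. The case \<open>n = 0\<close> is
  the zero map out of degree \<open>0\<close>.\<close>

definition hochschild_boundary :: "'a::real_algebra_1 tensor \<Rightarrow> 'a tensor" where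
  "hochschild_boundary = tensor_lift (\<lambda>as. let n = length as - 1 in
     if n = 0 then 0 else
     (\<Sum>i<n. (-1) ^ i *\<^sub>R tensor_of (take i as @ [as ! i * as ! (i + 1)] @ drop (i + 2) as))
     + (-1) ^ n *\<^sub>R tensor_of ([as ! n * as ! 0] @ tl (butlast as)))"

definition hochschild_complex :: "'a::real_algebra_1 tensor chain_cx" where
  "hochschild_complex = \<lparr>chains = (\<lambda>n. tensor_power (n + 1)), boundary = hochschild_boundary\<rparr>"

definition cyclic_complex :: "'a::real_algebra_1 cyclic_tensor chain_cx" where
  "cyclic_complex = \<lparr>chains = (\<lambda>n. abs_cyclic_tensor ` tensor_power (n + 1)),
     boundary = (\<lambda>c. abs_cyclic_tensor (hochschild_boundary (rep_cyclic_tensor c)))\<rparr>"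

abbreviation "HL br \<equiv> homology (leibniz_complex br)"
abbreviation "HLie br \<equiv> homology (lie_complex br)"
abbreviation "HH \<equiv> homology hochschild_complex"
abbreviation "HC \<equiv> homology cyclic_complex"

section \<open>The maps of the diagram\<close>

definition tensor_map :: "('a::real_vector \<Rightarrow> 'b::real_vector) \<Rightarrow> 'a tensor \<Rightarrow> 'b tensor"
  where "tensor_map h = tensor_lift (\<lambda>xs. tensor_of (map h xs))"

definition exterior_map :: "('a::real_vector \<Rightarrow> 'b::real_vector) \<Rightarrow> 'a exterior \<Rightarrow> 'b exterior"
  where "exterior_map h = exterior_lift (\<lambda>xs. wedge (map h xs))"

definition antisymmetrize :: "'a::real_vector list \<Rightarrow> 'a tensor" where
  "antisymmetrize as = (let n = length as - 1 in
     \<Sum>\<sigma> | \<sigma> permutes {1..n}.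
       of_int (sign \<sigma>) *\<^sub>R tensor_of (as ! 0 # map (\<lambda>i. as ! (Hilbert_Choice.inv \<sigma> i)) [1..<n + 1]))"

definition phi_chain :: "'a::real_vector tensor \<Rightarrow> 'a tensor"
  where "phi_chain = tensor_lift antisymmetrize"

definition theta_chain :: "'a::real_vector exterior \<Rightarrow> 'a cyclic_tensor"
  where "theta_chain = exterior_lift (\<lambda>as. abs_cyclic_tensor (antisymmetrize as))"

definition pi_star :: "('a::real_vector \<Rightarrow> 'a \<Rightarrow> 'a) \<Rightarrow> nat \<Rightarrow> 'a tensor set \<Rightarrow> 'a exterior set"
  where "pi_star br n = induced_map (lie_complex br) n abs_exterior"

definition mu1 :: "nat \<Rightarrow> 'a::lie_algebra tensor set \<Rightarrow> 'a uea tensor set"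
  where "mu1 n = induced_map (leibniz_complex commutator) n (tensor_map uea_inclusion)"

definition mu2 :: "nat \<Rightarrow> 'a::lie_algebra exterior set \<Rightarrow> 'a uea exterior set"
  where "mu2 n = induced_map (lie_complex commutator) n (exterior_map uea_inclusion)"

text \<open>The index is the degree \<open>n\<close> of the target: \<open>HL\<^bsub>n+1\<^esub> \<rightarrow> HH\<^sub>n\<close> and
  \<open>H\<^bsub>n+1\<^esub> \<rightarrow> HC\<^sub>n\<close>.\<close>

definition phi_star :: "nat \<Rightarrow> 'a::real_algebra_1 tensor set \<Rightarrow> 'a tensor set"
  where "phi_star n = induced_map hochschild_complex n phi_chain"

definition theta_star :: "nat \<Rightarrow> 'a::real_algebra_1 exterior set \<Rightarrow> 'a cyclic_tensor set"
  where "theta_star n = induced_map cyclic_complex n theta_chain"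

definition I_star :: "nat \<Rightarrow> 'a::real_algebra_1 tensor set \<Rightarrow> 'a cyclic_tensor set"
  where "I_star n = induced_map cyclic_complex n abs_cyclic_tensor"

definition godbillon_vey :: "poly_vector_field exterior set" where
  "godbillon_vey =
     homology_class (lie_complex lie_bracket) 3 (wedge [e_field (-1), e_field 0, e_field 1])"

abbreviation W_bracket :: "poly_vector_field \<Rightarrow> poly_vector_field \<Rightarrow> poly_vector_field"
  where "W_bracket \<equiv> lie_bracket"

abbreviation U_bracket ::
    "poly_vector_field uea \<Rightarrow> poly_vector_field uea \<Rightarrow> poly_vector_field uea"
  where "U_bracket \<equiv> commutator"

abbreviation HH_U :: "nat \<Rightarrow> poly_vector_field uea tensor set monoid"
  where "HH_U \<equiv> HH"

abbreviation HC_U :: "nat \<Rightarrow> poly_vector_field uea cyclic_tensor set monoid"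
  where "HC_U \<equiv> HC"

end

theory Submission
  imports Defs "HOL-Analysis.Product_Vector"
begin

text \<open>
  The arrows of the diagram are homomorphisms and the two squares commute, so a class in
  \<open>HL\<^sub>3(W)\<close> that lifts the Godbillon-Vey class can vanish nowhere in the diagram once its image in
  the last group \<open>HC\<^sub>2(U(W))\<close> is non-zero. Apart from the verification that all maps are well
  defined, two things carry the proof.

  \<^emph>\<open>The lift.\<close> The tensor \<open>e\<^bsub>-1\<^esub> \<otimes> e\<^sub>0 \<otimes> e\<^sub>1\<close> is no Leibniz cycle. Antisymmetrizing it in the first
  two entries leaves the symmetric boundary \<open>1/2 (e\<^bsub>-1\<^esub> \<otimes> e\<^sub>1 + e\<^sub>1 \<otimes> e\<^bsub>-1\<^esub>)\<close>, which
  \<open>1/6 e\<^bsub>-1\<^esub> \<otimes> e\<^bsub>-1\<^esub> \<otimes> e\<^sub>2\<close> cancels; the correction disappears in the exterior power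
  (\<open>boundary_gv_leibniz_cycle\<close>, \<open>abs_exterior_gv_leibniz_cycle\<close>).

  \<^emph>\<open>The non-vanishing.\<close> For every Lie algebra \<open>g\<close> the composite of \<open>\<theta>\<close> with Connes' map
  \<open>B : HC\<^sub>2(U(g)) \<rightarrow> HH\<^sub>3(U(g))\<close> and the augmentation \<open>HH\<^sub>3(U(g)) \<rightarrow> Tor\<^sub>3(\<real>, \<real>) = H\<^sub>3(g)\<close> is a
  non-zero multiple of the identity. Dually, a Hochschild 3-cocycle \<open>\<omega>\<close> on \<open>U(g)\<close> with trivial coefficients
  becomes a cyclic 2-cocycle when it is summed over the rotations of its arguments, and this cyclic
  cocycle takes on \<open>\<theta>(a \<and> b \<and> c)\<close> the value of the antisymmetrization of \<open>\<omega>\<close> at \<open>(a, b, c)\<close>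
  (locale \<open>trivial_coefficient_cocycle\<close>). It remains to extend the Gelfand-Fuchs cocycle, the
  antisymmetrization of \<open>f(0) g'(0) h''(0)\<close>, from \<open>W\<close> to \<open>U(W)\<close>. It is a Yoneda product: with
  \<open>\<Omega> = \<real>[x] dx\<close>, the three maps \<open>h \<mapsto> (r \<mapsto> r h'' dx)\<close>, \<open>g \<mapsto> (p dx \<mapsto> g' p dx)\<close> and
  \<open>f \<mapsto> (p dx \<mapsto> f(0) p(0))\<close> are 1-cocycles of \<open>W\<close> with values in \<open>Hom(\<real>, \<Omega>)\<close>, \<open>Hom(\<Omega>, \<Omega>)\<close> and
  \<open>Hom(\<Omega>, \<real>)\<close>. A 1-cocycle with values in \<open>Hom(B, A)\<close> is the same as a module structure on
  \<open>A \<oplus> B\<close> that extends \<open>B\<close> by \<open>A\<close>, and modules of \<open>W\<close> are modules of \<open>U(W)\<close>; so each factor extends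
  to \<open>U(W)\<close>, where it satisfies a Leibniz rule (\<open>ucocycle_times\<close>), and the product of the three is a
  Hochschild cocycle. At \<open>(e\<^bsub>-1\<^esub>, e\<^sub>0, e\<^sub>1)\<close>, that is for \<open>f = 1\<close>, \<open>g = x\<close>, \<open>h = x\<^sup>2\<close>, it is \<open>2\<close>, and
  it is \<open>0\<close> at every other ordering of these three fields.
\<close>

section \<open>Homology as a quotient group\<close>

text \<open>The part of a complex on which its homology in degree \<open>n\<close> depends.\<close>

locale complex_segment =
  fixes K :: "'v::real_vector chain_cx" and n :: nat
  assumes subspace_chains: "subspace (chains K n)"
    and subspace_chains_Suc: "subspace (chains K (Suc n))"
    and linear_boundary: "linear (boundary K)"
    and boundary_chains: "w \<in> chains K (Suc n) \<Longrightarrow> boundary K w \<in> chains K n"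
    and boundary_boundary: "w \<in> chains K (Suc n) \<Longrightarrow> boundary K (boundary K w) = 0"
begin

abbreviation cycles :: "'v set"
  where "cycles \<equiv> {z \<in> chains K n. boundary K z = 0}"

lemma subspace_cycles: "subspace cycles"
  using subspace_chains linear_boundary
  by (auto simp: subspace_def linear_add linear_scale linear_0)

lemma subspace_boundaries: "subspace (boundaries K n)"
  unfolding boundaries_def by (rule linear_subspace_image[OF linear_boundary subspace_chains_Suc])

lemma boundaries_subset: "boundaries K n \<subseteq> cycles"
  by (auto simp: boundaries_def boundary_chains boundary_boundary)

lemma comm_group_cycle_group: "comm_group (cycle_group K n)"
proof (rule comm_groupI)
  fix z assume "z \<in> carrier (cycle_group K n)"
  then show "\<exists>y\<in>carrier (cycle_group K n). y \<otimes>\<^bsub>cycle_group K n\<^esub> z = \<one>\<^bsub>cycle_group K n\<^esub>"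
    by (intro bexI[of _ "- z"])
      (use subspace_neg[OF subspace_cycles, of z] in \<open>auto simp: cycle_group_def\<close>)
qed (use subspace_add[OF subspace_cycles] subspace_0[OF subspace_cycles] in
      \<open>auto simp: cycle_group_def add_ac\<close>)

lemma normal_boundaries: "normal (boundaries K n) (cycle_group K n)"
proof -
  interpret comm_group "cycle_group K n" by (rule comm_group_cycle_group)
  have inv: "inv\<^bsub>cycle_group K n\<^esub> z = - z" if "z \<in> cycles" for z
    by (rule inv_equality) (use that subspace_neg[OF subspace_cycles that] in
      \<open>auto simp: cycle_group_def\<close>)
  show ?thesis
    by (rule subgroup_imp_normal, rule subgroupI)
      (use boundaries_subset subspace_0[OF subspace_boundaries] subspace_add[OF subspace_boundaries]
        subspace_neg[OF subspace_boundaries] inv in \<open>auto simp: cycle_group_def\<close>)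
qed

lemma group_homology: "group (homology K n)"
  unfolding homology_def by (rule normal.factorgroup_is_group[OF normal_boundaries])

lemma carrier_homology: "carrier (homology K n) = homology_class K n ` cycles"
  by (auto simp: homology_def FactGroup_def RCOSETS_def homology_class_def cycle_group_def)

lemma mult_homology_class:
  assumes "y \<in> cycles" "z \<in> cycles"
  shows "homology_class K n y \<otimes>\<^bsub>homology K n\<^esub> homology_class K n z = homology_class K n (y + z)"
  using normal.rcos_sum[OF normal_boundaries, of y z] assms
  by (simp add: homology_def FactGroup_def homology_class_def cycle_group_def)

lemma one_homology: "\<one>\<^bsub>homology K n\<^esub> = boundaries K n"
  by (simp add: homology_def FactGroup_def)

lemma mem_homology_class:
  "y \<in> homology_class K n z \<longleftrightarrow> y - z \<in> boundaries K n"
  by (force simp: homology_class_def r_coset_def cycle_group_def)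

lemma homology_class_eqI:
  assumes "y - z \<in> boundaries K n"
  shows "homology_class K n y = homology_class K n z"
proof -
  have "x - y \<in> boundaries K n \<longleftrightarrow> x - z \<in> boundaries K n" for x
    using subspace_add[OF subspace_boundaries _ assms, of "x - y"]
      subspace_diff[OF subspace_boundaries _ assms, of "x - z"] by auto
  then show ?thesis by (auto simp: mem_homology_class)
qed

lemma self_mem_homology_class: "z \<in> homology_class K n z"
  by (simp add: mem_homology_class subspace_0[OF subspace_boundaries])

end

text \<open>The degrees \<open>m\<close> and \<open>n\<close> may differ because \<open>\<phi>\<close> and \<open>\<theta>\<close> lower the degree by one.\<close>

locale segment_map =
  source: complex_segment K m + target: complex_segment L n
  for K :: "'v::real_vector chain_cx" and m and L :: "'w::real_vector chain_cx" and n +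
  fixes f :: "'v \<Rightarrow> 'w"
  assumes linear_map: "linear f"
    and map_chains: "w \<in> chains K m \<Longrightarrow> f w \<in> chains L n"
    and map_chains_Suc: "w \<in> chains K (Suc m) \<Longrightarrow> f w \<in> chains L (Suc n)"
    and map_boundary: "w \<in> chains K m \<or> w \<in> chains K (Suc m) \<Longrightarrow> boundary L (f w) = f (boundary K w)"
begin

lemma map_cycles: "z \<in> source.cycles \<Longrightarrow> f z \<in> target.cycles"
  by (auto simp: map_chains map_boundary linear_0[OF linear_map])

lemma map_boundaries: "w \<in> boundaries K m \<Longrightarrow> f w \<in> boundaries L n"
  unfolding boundaries_def
proof (elim imageE)
  fix v assume v: "w = boundary K v" "v \<in> chains K (Suc m)"
  then show "f w \<in> boundary L ` chains L (Suc n)"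
    by (intro image_eqI[of _ _ "f v"]) (simp_all add: map_chains_Suc map_boundary)
qed

lemma induced_map_class:
  "induced_map L n f (homology_class K m z) = homology_class L n (f z)"
proof -
  have "homology_class L n (f y) = homology_class L n (f z)" if "y \<in> homology_class K m z" for y
    by (rule target.homology_class_eqI)
      (use that map_boundaries in \<open>auto simp: source.mem_homology_class linear_diff[OF linear_map, symmetric]\<close>)
  then have "(\<lambda>y. homology_class L n (f y)) ` homology_class K m z = {homology_class L n (f z)}"
    using source.self_mem_homology_class by blast
  then show ?thesis by (simp add: induced_map_def)
qed

lemma induced_map_hom: "induced_map L n f \<in> hom (homology K m) (homology L n)"
proof (rule homI)
  fix c assume "c \<in> carrier (homology K m)"
  then show "induced_map L n f c \<in> carrier (homology L n)"
    using map_cycles by (force simp: source.carrier_homology target.carrier_homology induced_map_class)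
next
  fix c c' assume "c \<in> carrier (homology K m)" "c' \<in> carrier (homology K m)"
  then obtain y z where yz: "c = homology_class K m y" "y \<in> source.cycles"
      "c' = homology_class K m z" "z \<in> source.cycles"
    unfolding source.carrier_homology by blast
  then show "induced_map L n f (c \<otimes>\<^bsub>homology K m\<^esub> c') =
      induced_map L n f c \<otimes>\<^bsub>homology L n\<^esub> induced_map L n f c'"
    by (simp only: yz source.mult_homology_class target.mult_homology_class map_cycles
        induced_map_class linear_add[OF linear_map])
qed

lemma induced_map_one: "induced_map L n f \<one>\<^bsub>homology K m\<^esub> = \<one>\<^bsub>homology L n\<^esub>"
  by (rule hom_one[OF induced_map_hom source.group_homology target.group_homology])

end

section \<open>Multilinear functions of lists\<close>

text \<open>The signed sums below run over index sets that depend on the length of the list. With the list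
  fixed, hence also its length, linearity in each entry is inherited by such sums term by term.\<close>

definition multilinear_at :: "('a::real_vector list \<Rightarrow> 'b::real_vector) \<Rightarrow> 'a list \<Rightarrow> bool"
  where "multilinear_at f zs \<longleftrightarrow> (\<forall>k < length zs. linear (\<lambda>x. f (zs[k := x])))"

lemma multilinear_iff_at: "multilinear f \<longleftrightarrow> (\<forall>zs. multilinear_at f zs)"
proof
  assume f: "multilinear f"
  show "\<forall>zs. multilinear_at f zs"
    using f by (simp add: multilinear_def multilinear_at_def upd_conv_take_nth_drop)
next
  assume f: "\<forall>zs. multilinear_at f zs"
  show "multilinear f"
    unfolding multilinear_def
  proof (intro allI)
    fix xs ys
    have "linear (\<lambda>x. f ((xs @ 0 # ys)[length xs := x]))"
      using f unfolding multilinear_at_def by (metis add_Suc_right length_append length_Cons less_add_Suc1)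
    then show "linear (\<lambda>x. f (xs @ x # ys))" by (simp add: list_update_append)
  qed
qed

lemma multilinear_at_compose:
  "linear g \<Longrightarrow> multilinear_at f zs \<Longrightarrow> multilinear_at (\<lambda>xs. g (f xs)) zs"
  using linear_compose[of _ g] by (auto simp: multilinear_at_def o_def)

lemma multilinear_at_sum:
  assumes "\<And>i. i \<in> I (length zs) \<Longrightarrow> multilinear_at (f i) zs"
  shows "multilinear_at (\<lambda>xs. \<Sum>i\<in>I (length xs). f i xs) zs"
  using assms by (simp add: multilinear_at_def linear_compose_sum)

lemma multilinear_at_scaleR:
  "multilinear_at f zs \<Longrightarrow> multilinear_at (\<lambda>xs. c (length xs) *\<^sub>R f xs) zs"
  by (simp add: multilinear_at_def linear_compose_scale_right)

lemma multilinear_at_cong: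
  assumes "\<And>xs. length xs = length zs \<Longrightarrow> f xs = g xs"
  shows "multilinear_at f zs \<longleftrightarrow> multilinear_at g zs"
  by (simp add: multilinear_at_def assms)

lemma multilinear_compose: "linear g \<Longrightarrow> multilinear f \<Longrightarrow> multilinear (\<lambda>xs. g (f xs))"
  by (simp add: multilinear_iff_at multilinear_at_compose)

lemma multilinear_at_permuted_entries:
  assumes f: "multilinear f" and p: "p permutes {..<length zs}"
  shows "multilinear_at (\<lambda>xs. f (map (\<lambda>i. xs ! p i) [0..<length xs])) zs"
  unfolding multilinear_at_def
proof (intro allI impI)
  fix k assume k: "k < length zs"
  let ?ys = "map (\<lambda>i. zs ! p i) [0..<length zs]"
  have "map (\<lambda>i. zs[k := x] ! p i) [0..<length zs] = ?ys[Hilbert_Choice.inv p k := x]" for x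
  proof (rule nth_equalityI)
    fix i assume "i < length (map (\<lambda>i. zs[k := x] ! p i) [0..<length zs])"
    moreover then have "p i < length zs" using permutes_in_image[OF p, of i] by simp
    ultimately show "map (\<lambda>i. zs[k := x] ! p i) [0..<length zs] ! i = ?ys[Hilbert_Choice.inv p k := x] ! i"
      using k permutes_inv_eq[OF p, of k i] by (cases "p i = k") simp_all
  qed simp
  moreover have "Hilbert_Choice.inv p k < length zs"
    using permutes_in_image[OF permutes_inv[OF p], of k] k by simp
  ultimately show "linear (\<lambda>x. f (map (\<lambda>i. zs[k := x] ! p i) [0..<length (zs[k := x])]))"
    using f by (simp add: multilinear_iff_at multilinear_at_def)
qed

text \<open>Positions instead of decompositions of the list: the cancellations below are governed by
  positions.\<close>

lemma alternating_iff_adjacent: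
  "alternating f \<longleftrightarrow> multilinear f \<and> (\<forall>zs p. Suc p < length zs \<longrightarrow> zs ! p = zs ! Suc p \<longrightarrow> f zs = 0)"
  (is "_ \<longleftrightarrow> _ \<and> ?adj")
proof -
  have "(\<forall>xs x ys. f (xs @ x # x # ys) = 0) \<longleftrightarrow> ?adj"
  proof (intro iffI allI impI)
    fix zs :: "'a list" and p assume 0: "\<forall>xs x ys. f (xs @ x # x # ys) = 0"
      and p: "Suc p < length zs" "zs ! p = zs ! Suc p"
    have "zs = take p zs @ zs ! p # zs ! p # drop (Suc (Suc p)) zs"
      using p Cons_nth_drop_Suc[of p zs] Cons_nth_drop_Suc[of "Suc p" zs]
      by (metis Suc_lessD append_take_drop_id)
    then show "f zs = 0" using 0 by metis
  next
    fix xs x ys assume adj: ?adj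
    show "f (xs @ x # x # ys) = 0"
      using adj[rule_format, of "length xs" "xs @ x # x # ys"] by (simp add: nth_append)
  qed
  then show ?thesis by (simp add: alternating_def)
qed

text \<open>Polarization: expand \<open>f\<close> at a list that has \<open>x + y\<close> in both places.\<close>

lemma alternating_swap_adjacent:
  assumes f: "alternating f" and p: "Suc p < length zs"
  shows "f (zs[p := x, Suc p := y]) + f (zs[p := y, Suc p := x]) = 0"
proof -
  let ?f = "\<lambda>u v. f (zs[p := u, Suc p := v])"
  have adj: "f ws = 0" if "Suc p < length ws" "ws ! p = ws ! Suc p" for ws
    using f that unfolding alternating_iff_adjacent by blast
  have 0: "?f u u = 0" for u by (rule adj) (use p in simp_all)
  have m: "multilinear_at f ws" for ws
    using f by (simp add: alternating_def multilinear_iff_at)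
  have right: "linear (?f u)" for u
    using m[of "zs[p := u]"] p by (simp add: multilinear_at_def)
  have left: "linear (\<lambda>u. ?f u v)" for v
    using m[of "zs[Suc p := v]"] p by (simp add: multilinear_at_def list_update_swap[of p "Suc p"])
  have "?f (x + y) (x + y) = ?f x (x + y) + ?f y (x + y)" by (rule linear_add[OF left])
  moreover have "?f u (x + y) = ?f u x + ?f u y" for u by (rule linear_add[OF right])
  ultimately show ?thesis by (simp add: 0)
qed

lemma tensor_power_induct:
  assumes "t \<in> tensor_power n" "linear g" "subspace S"
    and "\<And>xs. length xs = n \<Longrightarrow> g (tensor_of xs) \<in> S"
  shows "g t \<in> S"
proof -
  have "tensor_of ` {xs. length xs = n} \<subseteq> g -` S" using assms(4) by auto
  then have "span (tensor_of ` {xs. length xs = n}) \<subseteq> g -` S"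
    by (rule span_minimal) (rule linear_subspace_vimage[OF assms(2,3)])
  then show ?thesis using assms(1) by (auto simp: tensor_power_def)
qed

lemma tensor_power_eqI:
  assumes "t \<in> tensor_power n" "linear f" "linear g"
    and "\<And>xs. length xs = n \<Longrightarrow> f (tensor_of xs) = g (tensor_of xs)"
  shows "f t = g t"
  by (rule linear_eq_on_span[OF assms(2,3) _ assms(1)[unfolded tensor_power_def]])
    (auto simp: assms(4))

lemma subspace_tensor_power: "subspace (tensor_power n)"
  by (simp add: tensor_power_def)

lemma tensor_of_mem_tensor_power: "length xs = n \<Longrightarrow> tensor_of xs \<in> tensor_power n"
  by (auto simp: tensor_power_def intro: span_base)

lemma tensor_lift_mem:
  assumes "multilinear f" "subspace S" "\<And>xs. length xs = n \<Longrightarrow> f xs \<in> S" "t \<in> tensor_power n"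
  shows "tensor_lift f t \<in> S"
  by (rule tensor_power_induct[OF assms(4) linear_tensor_lift[OF assms(1)] assms(2)])
    (simp add: tensor_lift_tensor_of[OF assms(1)] assms(3))

lemma multilinear_at_tensor_of: "multilinear_at tensor_of zs"
  by (rule multilinear_iff_at[THEN iffD1, rule_format, OF multilinear_tensor_of])

lemma linear_exterior_lift:
  assumes "alternating f" shows "linear (exterior_lift f)"
proof (rule linearI)
  have f: "linear (tensor_lift f)" by (rule linear_tensor_lift) (use assms in \<open>simp add: alternating_def\<close>)
  fix v w :: "'a exterior" and c :: real
  obtain s t where "v = abs_exterior s" "w = abs_exterior t" by (metis abs_rep_exterior)
  then show "exterior_lift f (v + w) = exterior_lift f v + exterior_lift f w"
    "exterior_lift f (c *\<^sub>R v) = c *\<^sub>R exterior_lift f v"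
    by (simp_all add: exterior_lift_abs[OF assms] plus_exterior.abs_eq scaleR_exterior.abs_eq
        linear_add[OF f] linear_scale[OF f])
qed

lemma alternating_wedge: "alternating wedge"
proof -
  have "wedge (xs @ x # x # ys) = 0" for xs ys :: "'a list" and x
  proof -
    have "tensor_of xs * tensor_of [x, x] * tensor_of ys \<in> multiples alternating_relations"
      by (rule multiplesI) (simp add: alternating_relations_def)
    then have "tensor_of (xs @ x # x # ys) - 0 \<in> span (multiples alternating_relations)"
      by (simp add: times_tensor_of span_base)
    then show ?thesis
      unfolding wedge_def zero_exterior_def by (simp only: exterior.abs_eq_iff)
  qed
  moreover have "multilinear (wedge :: 'a list \<Rightarrow> _)"
    unfolding wedge_def by (rule multilinear_compose[OF linear_abs_exterior multilinear_tensor_of])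
  ultimately show ?thesis by (simp add: alternating_def)
qed

section \<open>Contracting two entries of a list\<close>

text \<open>The terms of the Leibniz boundary and the faces of the Hochschild complex all contract two
  entries of a list into one, by the bracket or by the product, so that their multilinearity is the
  same fact.\<close>

lemma length_bracket_entries:
  "j < length gs \<Longrightarrow> length (bracket_entries br i j gs) = length gs - 1"
  by (simp add: bracket_entries_def Let_def)

lemma nth_bracket_entries:
  "i < j \<Longrightarrow> j < length gs \<Longrightarrow> k < length gs - 1 \<Longrightarrow>
    bracket_entries br i j gs ! k =
      (if k = i then br (gs ! i) (gs ! j) else gs ! (if k < j then k else Suc k))"
  by (auto simp: bracket_entries_def Let_def nth_append nth_list_update min_def)

lemma bracket_entries_update:
  assumes "i < j" "j < length gs" "k < length gs"
  shows "bracket_entries br i j (gs[k := x]) =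
    (if k = i then (bracket_entries br i j gs)[i := br x (gs ! j)]
     else if k = j then (bracket_entries br i j gs)[i := br (gs ! i) x]
     else (bracket_entries br i j gs)[(if k < j then k else k - 1) := x])"
  by (rule nth_equalityI)
    (use assms in \<open>auto simp: length_bracket_entries nth_bracket_entries nth_list_update\<close>)

lemma bracket_entries_map:
  assumes "i < j" "j < length gs" "\<And>x y. h (br x y) = br' (h x) (h y)"
  shows "bracket_entries br' i j (map h gs) = map h (bracket_entries br i j gs)"
  by (rule nth_equalityI)
    (use assms in \<open>auto simp: length_bracket_entries nth_bracket_entries\<close>)

locale bilinear_product =
  fixes br :: "'a::real_vector \<Rightarrow> 'a \<Rightarrow> 'a"
  assumes linear_left: "linear (\<lambda>x. br x y)" and linear_right: "linear (br x)"
begin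

lemma multilinear_at_bracket_entries:
  assumes f: "multilinear f" and ij: "i < j" "j < length zs"
  shows "multilinear_at (\<lambda>gs. f (bracket_entries br i j gs)) zs"
  unfolding multilinear_at_def
proof (intro allI impI)
  fix k assume k: "k < length zs"
  let ?B = "bracket_entries br i j zs"
  have upd: "linear (\<lambda>x. f (?B[l := x]))" if "l < length zs - 1" for l
    using f that ij by (simp add: multilinear_iff_at multilinear_at_def length_bracket_entries)
  have "linear (\<lambda>x. f (?B[i := br x (zs ! j)]))" "linear (\<lambda>x. f (?B[i := br (zs ! i) x]))"
    using linear_compose[OF linear_left upd[of i]] linear_compose[OF linear_right upd[of i]] ij
    by (simp_all add: o_def)
  with upd show "linear (\<lambda>x. f (bracket_entries br i j (zs[k := x])))"
    using ij k by (cases "k = i"; cases "k = j"; cases "k < j") (simp_all add: bracket_entries_update)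
qed

definition leibniz_sum :: "'a list \<Rightarrow> 'a tensor" where
  "leibniz_sum gs = (\<Sum>j<length gs. \<Sum>i<j. (-1) ^ (j + 1) *\<^sub>R tensor_of (bracket_entries br i j gs))"

lemma multilinear_leibniz_sum: "multilinear leibniz_sum"
  unfolding multilinear_iff_at leibniz_sum_def
  by (intro allI multilinear_at_sum multilinear_at_scaleR multilinear_at_bracket_entries
      multilinear_tensor_of) simp_all

lemma boundary_leibniz_complex: "boundary (leibniz_complex br) = tensor_lift leibniz_sum"
  by (simp add: leibniz_complex_def leibniz_sum_def[abs_def])

lemma linear_boundary_leibniz: "linear (boundary (leibniz_complex br))"
  unfolding boundary_leibniz_complex by (rule linear_tensor_lift[OF multilinear_leibniz_sum])

lemma boundary_leibniz_tensor_of: "boundary (leibniz_complex br) (tensor_of gs) = leibniz_sum gs"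
  unfolding boundary_leibniz_complex by (rule tensor_lift_tensor_of[OF multilinear_leibniz_sum])

lemma boundary_leibniz_chains:
  assumes "t \<in> tensor_power (Suc n)"
  shows "boundary (leibniz_complex br) t \<in> tensor_power n"
  unfolding boundary_leibniz_complex
proof (rule tensor_lift_mem[OF multilinear_leibniz_sum subspace_tensor_power _ assms])
  fix xs :: "'a list" assume "length xs = Suc n"
  then show "leibniz_sum xs \<in> tensor_power n"
    unfolding leibniz_sum_def
    by (intro subspace_sum subspace_tensor_power subspace_scale tensor_of_mem_tensor_power)
      (simp add: length_bracket_entries)
qed

end

section \<open>The Leibniz and the Lie complex\<close>

lemma length_3_conv: "length xs = 3 \<longleftrightarrow> (\<exists>a b c. xs = [a, b, c])"
  by (auto simp: numeral_3_eq_3 length_Suc_conv)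

lemma length_4_conv: "length xs = 4 \<longleftrightarrow> (\<exists>a b c d. xs = [a, b, c, d])"
  by (auto simp: eval_nat_numeral length_Suc_conv)

lemma linear_tensor_of_3:
  "linear (\<lambda>x. tensor_of [x, b, c])" "linear (\<lambda>x. tensor_of [a, x, c])" "linear (\<lambda>x. tensor_of [a, b, x])"
  using multilinear_tensor_of[unfolded multilinear_def, rule_format, of "[]" "[b, c]"]
    multilinear_tensor_of[unfolded multilinear_def, rule_format, of "[a]" "[c]"]
    multilinear_tensor_of[unfolded multilinear_def, rule_format, of "[a, b]" "[]"]
  by simp_all

lemma linear_tensor_of_2:
  "linear (\<lambda>x. tensor_of [x, b])" "linear (\<lambda>x. tensor_of [a, x])"
  using multilinear_tensor_of[unfolded multilinear_def, rule_format, of "[]" "[b]"]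
    multilinear_tensor_of[unfolded multilinear_def, rule_format, of "[a]" "[]"]
  by simp_all

context bilinear_product
begin

lemma leibniz_sum_3:
  "leibniz_sum [a, b, c] =
     tensor_of [br a b, c] - tensor_of [br a c, b] - tensor_of [a, br b c]"
  by (simp add: leibniz_sum_def bracket_entries_def eval_nat_numeral lessThan_Suc algebra_simps)

lemma leibniz_sum_4:
  "leibniz_sum [a, b, c, d] =
     tensor_of [br a b, c, d] - tensor_of [br a c, b, d] - tensor_of [a, br b c, d]
     + tensor_of [br a d, b, c] + tensor_of [a, br b d, c] + tensor_of [a, b, br c d]"
  by (simp add: leibniz_sum_def bracket_entries_def eval_nat_numeral lessThan_Suc algebra_simps)

end

text \<open>The Jacobi identity is taken in the form in which it cancels the terms of \<open>d \<circ> d\<close>: the bracket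
  with a bracket on the right is turned into brackets nested on the left.\<close>

locale lie_product = bilinear_product br for br :: "'a::real_vector \<Rightarrow> 'a \<Rightarrow> 'a" +
  assumes self: "br x x = 0"
    and leibniz_rule: "br x (br y z) = br (br x y) z - br (br x z) y"
begin

lemma boundary_boundary_leibniz:
  assumes "t \<in> tensor_power 4"
  shows "boundary (leibniz_complex br) (boundary (leibniz_complex br) t) = 0"
proof (rule tensor_power_eqI[OF assms, of "\<lambda>t. boundary (leibniz_complex br) (boundary (leibniz_complex br) t)" "\<lambda>_. 0"])
  note d = linear_boundary_leibniz
  show "linear (\<lambda>t. boundary (leibniz_complex br) (boundary (leibniz_complex br) t))"
    using linear_compose[OF d d] by (simp add: o_def)
  show "linear (\<lambda>_::'a tensor. 0 :: 'a tensor)" by (simp add: module_hom_zero)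
  fix xs :: "'a list" assume "length xs = 4"
  then obtain a b c e where xs: "xs = [a, b, c, e]" by (auto simp: length_4_conv)
  have "leibniz_sum [br a b, c, e] - leibniz_sum [br a c, b, e] - leibniz_sum [a, br b c, e]
     + leibniz_sum [br a e, b, c] + leibniz_sum [a, br b e, c] + leibniz_sum [a, b, br c e] = 0"
    by (simp add: leibniz_sum_3 leibniz_rule linear_diff[OF linear_tensor_of_2(1)]
        linear_diff[OF linear_tensor_of_2(2)])
  then show "boundary (leibniz_complex br) (boundary (leibniz_complex br) (tensor_of xs)) = 0"
    by (simp add: xs boundary_leibniz_tensor_of leibniz_sum_4 linear_add[OF d] linear_diff[OF d])
qed

lemma complex_segment_leibniz: "complex_segment (leibniz_complex br) 3"
proof (rule complex_segment.intro)
  have chains: "chains (leibniz_complex br) = tensor_power" by (simp add: leibniz_complex_def)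
  show "subspace (chains (leibniz_complex br) 3)" "subspace (chains (leibniz_complex br) (Suc 3))"
    by (simp_all add: chains subspace_tensor_power)
  show "linear (boundary (leibniz_complex br))" by (rule linear_boundary_leibniz)
  fix w :: "'a tensor" assume "w \<in> chains (leibniz_complex br) (Suc 3)"
  then show "boundary (leibniz_complex br) w \<in> chains (leibniz_complex br) 3"
    "boundary (leibniz_complex br) (boundary (leibniz_complex br) w) = 0"
    by (simp_all add: chains boundary_leibniz_chains boundary_boundary_leibniz)
qed

definition lie_sum :: "'a list \<Rightarrow> 'a exterior" where
  "lie_sum gs = (\<Sum>j<length gs. \<Sum>i<j. (-1) ^ (j + 1) *\<^sub>R wedge (bracket_entries br i j gs))"

lemma abs_exterior_leibniz_sum: "abs_exterior (leibniz_sum gs) = lie_sum gs"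
  by (simp add: leibniz_sum_def lie_sum_def wedge_def linear_sum[OF linear_abs_exterior]
      linear_scale[OF linear_abs_exterior] linear_neg[OF linear_abs_exterior])

text \<open>Suppose the entries at \<open>p\<close> and \<open>p + 1\<close> agree. Contractions that touch neither leave two equal
  neighbours, and contracting the two with each other gives \<open>[x, x] = 0\<close>. Contracting a later entry
  into the one or into the other produces two lists that differ by exchanging neighbours and have
  the same sign; contracting the one or the other into an earlier entry produces the same list with
  opposite signs.\<close>

lemma alternating_lie_sum: "alternating lie_sum"
  unfolding alternating_iff_adjacent
proof (intro conjI allI impI)
  show "multilinear lie_sum"
    using multilinear_compose[OF linear_abs_exterior multilinear_leibniz_sum]
    by (simp add: abs_exterior_leibniz_sum)
next
  fix zs :: "'a list" and p
  assume p: "Suc p < length zs" and eq: "zs ! p = zs ! Suc p"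
  define W where "W i j = wedge (bracket_entries br i j zs)" for i j
  define s :: "nat \<Rightarrow> real" where "s j = (-1) ^ (j + 1)" for j
  have adj: "wedge ws = 0" if "Suc q < length ws" "ws ! q = ws ! Suc q" for q and ws :: "'a list"
    using alternating_wedge that unfolding alternating_iff_adjacent by blast
  have both: "W p (Suc p) = 0"
  proof -
    have "bracket_entries br p (Suc p) zs = (bracket_entries br p (Suc p) zs)[p := 0]"
      by (rule nth_equalityI)
        (use p eq self in \<open>auto simp: length_bracket_entries nth_bracket_entries nth_list_update\<close>)
    moreover have "p < length (bracket_entries br p (Suc p) zs)"
      using p by (simp add: length_bracket_entries)
    then have "linear (\<lambda>x. wedge ((bracket_entries br p (Suc p) zs)[p := x]))"
      using alternating_wedge[unfolded alternating_def multilinear_iff_at multilinear_at_def] by blast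
    ultimately show ?thesis unfolding W_def using linear_0 by metis
  qed
  have none: "W i j = 0" if "i < j" "j < length zs" "i \<notin> {p, Suc p}" "j \<notin> {p, Suc p}" for i j
    unfolding W_def
    by (rule adj[of "if p < j then p else p - 1"])
      (use that p eq in \<open>auto simp: length_bracket_entries nth_bracket_entries\<close>)
  have right: "W p j + W (Suc p) j = 0" if j: "Suc p < j" "j < length zs" for j
  proof -
    let ?B = "bracket_entries br p j zs"
    let ?x = "zs ! p" and ?y = "br (zs ! p) (zs ! j)"
    have "?B = ?B[p := ?y, Suc p := ?x]"
      by (rule nth_equalityI)
        (use j p eq in \<open>auto simp: length_bracket_entries nth_bracket_entries nth_list_update\<close>)
    moreover have "bracket_entries br (Suc p) j zs = ?B[p := ?x, Suc p := ?y]"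
      by (rule nth_equalityI)
        (use j p eq in \<open>auto simp: length_bracket_entries nth_bracket_entries nth_list_update\<close>)
    ultimately show ?thesis
      unfolding W_def using alternating_swap_adjacent[OF alternating_wedge, of p ?B ?y ?x] j p
      by (simp add: length_bracket_entries)
  qed
  have left: "W i p = W i (Suc p)" if i: "i < p" for i
  proof -
    have "bracket_entries br i p zs = bracket_entries br i (Suc p) zs"
      by (rule nth_equalityI)
        (use i p eq in \<open>auto simp: length_bracket_entries nth_bracket_entries less_Suc_eq\<close>)
    then show ?thesis by (simp add: W_def)
  qed
  define T where "T j = (\<Sum>i<j. s j *\<^sub>R W i j)" for j
  have other: "T j = 0" if j: "j < length zs" "j \<notin> {p, Suc p}" for j
  proof (cases "j < p")
    case True
    then show ?thesis unfolding T_def using j by (intro sum.neutral) (auto simp: none)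
  next
    case False
    with j have pj: "Suc p < j" by auto
    have "T j = (\<Sum>i\<in>{p, Suc p}. s j *\<^sub>R W i j)"
      unfolding T_def using j pj by (intro sum.mono_neutral_right) (auto simp: none)
    also have "\<dots> = s j *\<^sub>R (W p j + W (Suc p) j)" by (simp add: scaleR_add_right)
    finally show ?thesis using right[OF pj j(1)] by simp
  qed
  have "lie_sum zs = (\<Sum>j<length zs. T j)"
    by (simp add: lie_sum_def T_def s_def W_def)
  also have "\<dots> = (\<Sum>j\<in>{p, Suc p}. T j)"
    using p other by (intro sum.mono_neutral_right) auto
  also have "\<dots> = T p + T (Suc p)" by simp
  also have "T (Suc p) = (\<Sum>i<p. s (Suc p) *\<^sub>R W i p)"
    unfolding T_def by (simp add: both left)
  also have "T p + \<dots> = 0" by (simp add: T_def s_def sum_negf)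
  finally show "lie_sum zs = 0" .
qed

lemma boundary_lie_complex: "boundary (lie_complex br) = exterior_lift lie_sum"
  by (simp add: lie_complex_def lie_sum_def[abs_def])

lemma boundary_lie_abs_exterior:
  "boundary (lie_complex br) (abs_exterior t) = abs_exterior (boundary (leibniz_complex br) t)"
proof (rule tensor_linear_eqI[of "\<lambda>t. boundary (lie_complex br) (abs_exterior t)"
      "\<lambda>t. abs_exterior (boundary (leibniz_complex br) t)"])
  show "linear (\<lambda>t. boundary (lie_complex br) (abs_exterior t))"
    using linear_compose[OF linear_abs_exterior linear_exterior_lift[OF alternating_lie_sum]]
    by (simp add: o_def boundary_lie_complex)
  show "linear (\<lambda>t. abs_exterior (boundary (leibniz_complex br) t))"
    using linear_compose[OF linear_boundary_leibniz linear_abs_exterior] by (simp add: o_def)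
qed (simp add: boundary_lie_complex wedge_def[symmetric] exterior_lift_wedge[OF alternating_lie_sum]
      boundary_leibniz_tensor_of abs_exterior_leibniz_sum)

lemma complex_segment_lie: "complex_segment (lie_complex br) 3"
proof (rule complex_segment.intro)
  have chains: "chains (lie_complex br) n = abs_exterior ` tensor_power n" for n
    by (simp add: lie_complex_def exterior_power_def)
  show "subspace (chains (lie_complex br) 3)" "subspace (chains (lie_complex br) (Suc 3))"
    unfolding chains by (intro linear_subspace_image linear_abs_exterior subspace_tensor_power)+
  show "linear (boundary (lie_complex br))"
    unfolding boundary_lie_complex by (rule linear_exterior_lift[OF alternating_lie_sum])
  fix w assume "w \<in> chains (lie_complex br) (Suc 3)"
  then obtain t where t: "w = abs_exterior t" "t \<in> tensor_power (Suc 3)"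
    unfolding chains by blast
  then show "boundary (lie_complex br) w \<in> chains (lie_complex br) 3"
    "boundary (lie_complex br) (boundary (lie_complex br) w) = 0"
    by (simp_all add: chains boundary_lie_abs_exterior boundary_leibniz_chains boundary_boundary_leibniz
        linear_0[OF linear_abs_exterior])
qed

lemma segment_map_projection:
  "segment_map (leibniz_complex br) 3 (lie_complex br) 3 abs_exterior"
proof (intro segment_map.intro segment_map_axioms.intro complex_segment_leibniz complex_segment_lie
    linear_abs_exterior)
  show "boundary (lie_complex br) (abs_exterior w) = abs_exterior (boundary (leibniz_complex br) w)" for w
    by (rule boundary_lie_abs_exterior)
qed (auto simp: leibniz_complex_def lie_complex_def exterior_power_def)

end

section \<open>Functoriality\<close>

locale lie_product_map =
  source: lie_product br + target: lie_product br'
  for br :: "'a::real_vector \<Rightarrow> 'a \<Rightarrow> 'a" and br' :: "'b::real_vector \<Rightarrow> 'b \<Rightarrow> 'b" +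
  fixes h :: "'a \<Rightarrow> 'b"
  assumes linear_h: "linear h" and h_bracket: "h (br x y) = br' (h x) (h y)"
begin

lemma multilinear_map: "multilinear (\<lambda>xs. f (map h xs))" if "multilinear f"
  unfolding multilinear_iff_at multilinear_at_def
proof (intro allI impI)
  fix zs :: "'a list" and k assume "k < length zs"
  then have "linear (\<lambda>y. f ((map h zs)[k := y]))"
    using that by (simp add: multilinear_iff_at multilinear_at_def)
  from linear_compose[OF linear_h this] show "linear (\<lambda>x. f (map h (zs[k := x])))"
    by (simp add: o_def map_update)
qed

lemma linear_tensor_map: "linear (tensor_map h)"
  unfolding tensor_map_def by (rule linear_tensor_lift[OF multilinear_map[OF multilinear_tensor_of]])

lemma tensor_map_tensor_of: "tensor_map h (tensor_of xs) = tensor_of (map h xs)"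
  unfolding tensor_map_def by (rule tensor_lift_tensor_of[OF multilinear_map[OF multilinear_tensor_of]])

lemma tensor_map_chains: "t \<in> tensor_power n \<Longrightarrow> tensor_map h t \<in> tensor_power n"
  by (rule tensor_power_induct[OF _ linear_tensor_map subspace_tensor_power])
    (auto simp: tensor_map_tensor_of intro: tensor_of_mem_tensor_power)

lemma tensor_map_boundary:
  "boundary (leibniz_complex br') (tensor_map h t) = tensor_map h (boundary (leibniz_complex br) t)"
proof (rule tensor_linear_eqI[of "\<lambda>t. boundary (leibniz_complex br') (tensor_map h t)"
      "\<lambda>t. tensor_map h (boundary (leibniz_complex br) t)"])
  show "linear (\<lambda>t. boundary (leibniz_complex br') (tensor_map h t))"
    using linear_compose[OF linear_tensor_map target.linear_boundary_leibniz] by (simp add: o_def)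
  show "linear (\<lambda>t. tensor_map h (boundary (leibniz_complex br) t))"
    using linear_compose[OF source.linear_boundary_leibniz linear_tensor_map] by (simp add: o_def)
  fix xs
  have "tensor_of (bracket_entries br' i j (map h xs)) = tensor_map h (tensor_of (bracket_entries br i j xs))"
    if "i < j" "j < length xs" for i j
    using that by (simp add: bracket_entries_map[of i j xs h br br', OF _ _ h_bracket] tensor_map_tensor_of)
  then show "boundary (leibniz_complex br') (tensor_map h (tensor_of xs)) =
      tensor_map h (boundary (leibniz_complex br) (tensor_of xs))"
    by (simp add: tensor_map_tensor_of source.boundary_leibniz_tensor_of target.boundary_leibniz_tensor_of
        source.leibniz_sum_def target.leibniz_sum_def linear_sum[OF linear_tensor_map]
        linear_scale[OF linear_tensor_map] linear_neg[OF linear_tensor_map])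
qed

lemma alternating_wedge_map: "alternating (\<lambda>xs. wedge (map h xs))"
  using alternating_wedge[where ?'a = 'b] multilinear_map[of wedge] by (simp add: alternating_def)

lemma linear_exterior_map: "linear (exterior_map h)"
  unfolding exterior_map_def by (rule linear_exterior_lift[OF alternating_wedge_map])

lemma exterior_map_abs: "exterior_map h (abs_exterior t) = abs_exterior (tensor_map h t)"
proof -
  have "exterior_map h (abs_exterior t) = tensor_lift (\<lambda>xs. wedge (map h xs)) t"
    unfolding exterior_map_def by (rule exterior_lift_abs[OF alternating_wedge_map])
  also have "\<dots> = abs_exterior (tensor_map h t)"
  proof (rule tensor_linear_eqI[of "tensor_lift (\<lambda>xs. wedge (map h xs))" "\<lambda>t. abs_exterior (tensor_map h t)"])
    show "linear (tensor_lift (\<lambda>xs. wedge (map h xs)))"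
      by (rule linear_tensor_lift) (use alternating_wedge_map in \<open>simp add: alternating_def\<close>)
    show "linear (\<lambda>t. abs_exterior (tensor_map h t))"
      using linear_compose[OF linear_tensor_map linear_abs_exterior] by (simp add: o_def)
    show "tensor_lift (\<lambda>xs. wedge (map h xs)) (tensor_of xs) = abs_exterior (tensor_map h (tensor_of xs))" for xs
      using alternating_wedge_map
      by (simp add: tensor_lift_tensor_of alternating_def tensor_map_tensor_of wedge_def)
  qed
  finally show ?thesis .
qed

lemma segment_map_tensor_map:
  "segment_map (leibniz_complex br) 3 (leibniz_complex br') 3 (tensor_map h)"
proof (intro segment_map.intro segment_map_axioms.intro source.complex_segment_leibniz
    target.complex_segment_leibniz linear_tensor_map)
  show "boundary (leibniz_complex br') (tensor_map h w) = tensor_map h (boundary (leibniz_complex br) w)" for w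
    by (rule tensor_map_boundary)
qed (simp_all add: leibniz_complex_def tensor_map_chains)

lemma segment_map_exterior_map:
  "segment_map (lie_complex br) 3 (lie_complex br') 3 (exterior_map h)"
proof (intro segment_map.intro segment_map_axioms.intro source.complex_segment_lie
    target.complex_segment_lie linear_exterior_map)
  fix w :: "'a exterior"
  obtain t where "w = abs_exterior t" by (metis abs_rep_exterior)
  then show "boundary (lie_complex br') (exterior_map h w) = exterior_map h (boundary (lie_complex br) w)"
    by (simp add: exterior_map_abs source.boundary_lie_abs_exterior target.boundary_lie_abs_exterior
        tensor_map_boundary)
qed (auto simp: lie_complex_def exterior_power_def exterior_map_abs tensor_map_chains)

end

section \<open>The Hochschild complex\<close>

lemma bilinear_product_times: "bilinear_product ((*) :: 'a::real_algebra_1 \<Rightarrow> 'a \<Rightarrow> 'a)"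
  by (intro bilinear_product.intro linearI) (simp_all add: algebra_simps)

lemma bilinear_product_flip:
  "bilinear_product (\<lambda>x y :: 'a::real_vector. br y x)" if "bilinear_product br"
  using that by (simp add: bilinear_product_def)

text \<open>The last face multiplies the last entry into the first from the left. It is a contraction of the
  positions \<open>0\<close> and \<open>n\<close> for the opposite product.\<close>

definition hochschild_face :: "nat \<Rightarrow> 'a::real_algebra_1 list \<Rightarrow> 'a list" where
  "hochschild_face i as =
     (if Suc i < length as then bracket_entries (*) i (Suc i) as
      else bracket_entries (\<lambda>x y. y * x) 0 i as)"

definition hochschild_sum :: "'a::real_algebra_1 list \<Rightarrow> 'a tensor" where
  "hochschild_sum as = (if length as \<le> 1 then 0
     else \<Sum>i<length as. (-1) ^ i *\<^sub>R tensor_of (hochschild_face i as))"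

lemma hochschild_boundary_eq: "hochschild_boundary = tensor_lift hochschild_sum"
proof -
  have "(let n = length as - 1 in
     if n = 0 then 0 else
     (\<Sum>i<n. (-1) ^ i *\<^sub>R tensor_of (take i as @ [as ! i * as ! (i + 1)] @ drop (i + 2) as))
     + (-1) ^ n *\<^sub>R tensor_of ([as ! n * as ! 0] @ tl (butlast as))) = hochschild_sum as"
    for as :: "'a list"
  proof (cases "length as \<le> 1")
    case False
    then obtain n where n: "length as = Suc n" "n > 0" by (cases "length as") auto
    have inner: "take i as @ [as ! i * as ! (i + 1)] @ drop (i + 2) as = hochschild_face i as"
      if "i < n" for i
      by (rule nth_equalityI)
        (use that n in \<open>auto simp: hochschild_face_def length_bracket_entries nth_bracket_entries
          nth_append nth_Cons min_def split: nat.split intro!: arg_cong[of _ _ "nth as"]\<close>)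
    have last: "[as ! n * as ! 0] @ tl (butlast as) = hochschild_face n as"
      by (rule nth_equalityI)
        (use n in \<open>auto simp: hochschild_face_def length_bracket_entries nth_bracket_entries
          nth_append nth_Cons nth_tl nth_butlast split: nat.split\<close>)
    show ?thesis
      using n inner last by (simp add: hochschild_sum_def Let_def)
  qed (simp add: hochschild_sum_def)
  then show ?thesis by (simp add: hochschild_boundary_def)
qed

lemma length_hochschild_face: "i < length as \<Longrightarrow> length (hochschild_face i as) = length as - 1"
  by (simp add: hochschild_face_def length_bracket_entries)

lemma multilinear_hochschild_sum: "multilinear (hochschild_sum :: 'a::real_algebra_1 list \<Rightarrow> _)"
  unfolding multilinear_iff_at
proof
  fix zs :: "'a list"
  show "multilinear_at hochschild_sum zs"
  proof (cases "length zs \<le> 1")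
    case True
    then have "multilinear_at hochschild_sum zs \<longleftrightarrow> multilinear_at (\<lambda>_. 0 :: 'a tensor) zs"
      by (intro multilinear_at_cong) (simp add: hochschild_sum_def)
    then show ?thesis by (simp add: multilinear_at_def module_hom_zero)
  next
    case False
    have face: "multilinear_at (\<lambda>as. tensor_of (hochschild_face i as)) zs" if i: "i < length zs" for i
    proof (cases "Suc i < length zs")
      case True
      have "multilinear_at (\<lambda>as. tensor_of (hochschild_face i as)) zs \<longleftrightarrow>
          multilinear_at (\<lambda>as. tensor_of (bracket_entries (*) i (Suc i) as)) zs"
        by (rule multilinear_at_cong) (use True in \<open>simp add: hochschild_face_def\<close>)
      then show ?thesis
        using True by (simp add: bilinear_product.multilinear_at_bracket_entries
            [OF bilinear_product_times multilinear_tensor_of])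
    next
      case last: False
      have "multilinear_at (\<lambda>as. tensor_of (hochschild_face i as)) zs \<longleftrightarrow>
          multilinear_at (\<lambda>as. tensor_of (bracket_entries (\<lambda>x y. y * x) 0 i as)) zs"
        by (rule multilinear_at_cong) (use last in \<open>simp add: hochschild_face_def\<close>)
      then show ?thesis
        using i last False by (simp add: bilinear_product.multilinear_at_bracket_entries
            [OF bilinear_product_flip[OF bilinear_product_times] multilinear_tensor_of])
    qed
    have "multilinear_at hochschild_sum zs \<longleftrightarrow>
        multilinear_at (\<lambda>as. \<Sum>i<length as. (-1) ^ i *\<^sub>R tensor_of (hochschild_face i as)) zs"
      by (rule multilinear_at_cong) (use False in \<open>simp add: hochschild_sum_def\<close>)
    also have \<dots> by (intro multilinear_at_sum multilinear_at_scaleR face) simp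
    finally show ?thesis .
  qed
qed

lemma linear_hochschild_boundary: "linear hochschild_boundary"
  unfolding hochschild_boundary_eq by (rule linear_tensor_lift[OF multilinear_hochschild_sum])

lemma hochschild_boundary_tensor_of: "hochschild_boundary (tensor_of as) = hochschild_sum as"
  unfolding hochschild_boundary_eq by (rule tensor_lift_tensor_of[OF multilinear_hochschild_sum])

lemma hochschild_sum_3:
  "hochschild_sum [a, b, c] = tensor_of [a * b, c] - tensor_of [a, b * c] + tensor_of [c * a, b]"
  by (simp add: hochschild_sum_def hochschild_face_def bracket_entries_def eval_nat_numeral
      lessThan_Suc algebra_simps)

lemma hochschild_sum_4:
  "hochschild_sum [a, b, c, d] = tensor_of [a * b, c, d] - tensor_of [a, b * c, d]
     + tensor_of [a, b, c * d] - tensor_of [d * a, b, c]"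
  by (simp add: hochschild_sum_def hochschild_face_def bracket_entries_def eval_nat_numeral
      lessThan_Suc algebra_simps)

lemma hochschild_boundary_chains:
  assumes "t \<in> tensor_power (Suc n)"
  shows "hochschild_boundary t \<in> tensor_power n"
  unfolding hochschild_boundary_eq
proof (rule tensor_lift_mem[OF multilinear_hochschild_sum subspace_tensor_power _ assms])
  fix xs :: "'a list" assume "length xs = Suc n"
  then show "hochschild_sum xs \<in> tensor_power n"
    by (auto simp: hochschild_sum_def length_hochschild_face subspace_0[OF subspace_tensor_power]
        simp del: sum.lessThan_Suc
        intro!: subspace_sum subspace_tensor_power subspace_scale tensor_of_mem_tensor_power)
qed

lemma hochschild_boundary_boundary:
  assumes "t \<in> tensor_power 4"
  shows "hochschild_boundary (hochschild_boundary t) = 0"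
proof (rule tensor_power_eqI[OF assms, of "\<lambda>t. hochschild_boundary (hochschild_boundary t)" "\<lambda>_. 0"])
  note b = linear_hochschild_boundary
  show "linear (\<lambda>t::'a tensor. hochschild_boundary (hochschild_boundary t))"
    using linear_compose[OF b b] by (simp add: o_def)
  show "linear (\<lambda>_::'a tensor. 0 :: 'a tensor)" by (simp add: module_hom_zero)
  fix xs :: "'a list" assume "length xs = 4"
  then obtain a b c d where "xs = [a, b, c, d]" by (auto simp: length_4_conv)
  then show "hochschild_boundary (hochschild_boundary (tensor_of xs)) = 0"
    by (simp add: hochschild_boundary_tensor_of hochschild_sum_4 hochschild_sum_3 linear_add[OF b]
        linear_diff[OF b] mult.assoc)
qed

lemma complex_segment_hochschild: "complex_segment hochschild_complex 2"
  by (rule complex_segment.intro)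
    (simp_all add: hochschild_complex_def subspace_tensor_power linear_hochschild_boundary
      hochschild_boundary_chains[of _ 3, simplified] hochschild_boundary_boundary[simplified])

section \<open>The cyclic complex\<close>

lemma linear_abs_cyclic: "linear abs_cyclic_tensor"
  by (rule linearI) (simp_all add: plus_cyclic_tensor.abs_eq scaleR_cyclic_tensor.abs_eq)

lemma abs_rep_cyclic: "abs_cyclic_tensor (rep_cyclic_tensor c) = c"
  by (rule Quotient_abs_rep[OF Quotient_cyclic_tensor])

lemma cyclic_predecessor:
  fixes i N :: nat
  assumes "i < N" shows "(N - 1 + i) mod N = (if i = 0 then N - 1 else i - 1)"
proof (cases i)
  case (Suc m)
  then have "N - 1 + i = m + N" using assms by simp
  then show ?thesis using Suc assms by simp
qed (use assms in simp)

lemma multilinear_cyclic_operator: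
  "multilinear (\<lambda>as. (-1) ^ (length as - 1) *\<^sub>R tensor_of (rotate (length as - 1) as))"
  unfolding multilinear_iff_at
proof (intro allI multilinear_at_scaleR)
  fix zs :: "'a list"
  let ?n = "length zs"
  show "multilinear_at (\<lambda>as. tensor_of (rotate (length as - 1) as)) zs"
    unfolding multilinear_at_def
  proof (intro allI impI)
    fix k assume k: "k < ?n"
    have "rotate (?n - 1) (zs[k := x]) = (rotate (?n - 1) zs)[Suc k mod ?n := x]" for x
    proof (rule nth_equalityI)
      fix i assume "i < length (rotate (?n - 1) (zs[k := x]))"
      then have i: "i < ?n" by simp
      have "(?n - 1 + i) mod ?n = (if i = 0 then ?n - 1 else i - 1)"
        by (rule cyclic_predecessor[OF i])
      moreover have "Suc k mod ?n = (if Suc k = ?n then 0 else Suc k)"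
        using k by (auto simp: mod_Suc)
      ultimately have "(?n - 1 + i) mod ?n = k \<longleftrightarrow> i = Suc k mod ?n"
        using i k by (cases i) auto
      then show "rotate (?n - 1) (zs[k := x]) ! i = (rotate (?n - 1) zs)[Suc k mod ?n := x] ! i"
        using i k by (auto simp: nth_rotate nth_list_update)
    qed simp
    moreover have "Suc k mod ?n < length (rotate (?n - 1) zs)"
      using k mod_less_divisor[of ?n "Suc k"] by (metis gr_implies_not0 length_rotate not_gr_zero)
    ultimately show "linear (\<lambda>x. tensor_of (rotate (length (zs[k := x]) - 1) (zs[k := x])))"
      using multilinear_at_tensor_of[of "rotate (?n - 1) zs"] by (simp add: multilinear_at_def)
  qed
qed

lemma linear_cyclic_operator: "linear cyclic_operator"
  unfolding cyclic_operator_def by (rule linear_tensor_lift[OF multilinear_cyclic_operator])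

lemma cyclic_operator_tensor_of:
  "cyclic_operator (tensor_of as) = (-1) ^ (length as - 1) *\<^sub>R tensor_of (rotate (length as - 1) as)"
  unfolding cyclic_operator_def by (rule tensor_lift_tensor_of[OF multilinear_cyclic_operator])

lemma abs_cyclic_operator: "abs_cyclic_tensor (cyclic_operator w) = abs_cyclic_tensor w"
proof -
  have "w - cyclic_operator w \<in> span (range (\<lambda>w. w - cyclic_operator w))" by (intro span_base) blast
  then show ?thesis unfolding cyclic_tensor.abs_eq_iff[symmetric] by simp
qed

text \<open>A cyclically invariant linear map factors through the cyclic quotient.\<close>

lemma abs_cyclic_lift:
  assumes "linear g" "\<And>w. g (cyclic_operator w) = g w" "abs_cyclic_tensor s = abs_cyclic_tensor t"
  shows "g s = g t"
  by (rule linear_eq_mod_span[OF assms(1) _ assms(3)[unfolded cyclic_tensor.abs_eq_iff]])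
    (auto simp: assms(2) linear_diff[OF assms(1)])

text \<open>The Hochschild boundary descends to the cyclic quotient: writing \<open>d\<^sub>i\<close> for the faces and \<open>t\<close> for
  the rotation of an \<open>(n+1)\<close>-fold tensor without its sign, \<open>d\<^sub>0 t = d\<^sub>n\<close> and \<open>d\<^bsub>i+1\<^esub> t = t d\<^sub>i\<close>, and the signs
  of \<open>t\<close> in the degrees \<open>n\<close> and \<open>n - 1\<close> compensate the shift of the index.\<close>

lemma abs_cyclic_hochschild_cyclic:
  "abs_cyclic_tensor (hochschild_boundary (cyclic_operator w)) = abs_cyclic_tensor (hochschild_boundary w)"
proof (rule tensor_linear_eqI[of "\<lambda>w. abs_cyclic_tensor (hochschild_boundary (cyclic_operator w))"
      "\<lambda>w. abs_cyclic_tensor (hochschild_boundary w)"])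
  show "linear (\<lambda>w::'a tensor. abs_cyclic_tensor (hochschild_boundary (cyclic_operator w)))"
    using linear_compose[OF linear_cyclic_operator linear_compose[OF linear_hochschild_boundary linear_abs_cyclic]]
    by (simp add: o_def)
  show "linear (\<lambda>w::'a tensor. abs_cyclic_tensor (hochschild_boundary w))"
    using linear_compose[OF linear_hochschild_boundary linear_abs_cyclic] by (simp add: o_def)
  fix as :: "'a list"
  show "abs_cyclic_tensor (hochschild_boundary (cyclic_operator (tensor_of as))) =
      abs_cyclic_tensor (hochschild_boundary (tensor_of as))"
  proof (cases "length as \<le> 1")
    case True
    then show ?thesis
      by (simp add: cyclic_operator_tensor_of hochschild_boundary_tensor_of)
  next
    case False
    then obtain n where n: "length as = Suc n" "n > 0" by (cases "length as") auto
    let ?r = "rotate n as"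
    define C where "C xs = abs_cyclic_tensor (tensor_of xs)" for xs :: "'a list"
    have r: "?r ! i = (if i = 0 then as ! n else as ! (i - 1))" if "i \<le> n" for i
      using that n cyclic_predecessor[of i "Suc n"] by (simp add: nth_rotate)
    have first: "hochschild_face 0 ?r = hochschild_face n as"
      by (rule nth_equalityI)
        (use n r in \<open>auto simp: length_hochschild_face, auto simp: hochschild_face_def
          length_bracket_entries nth_bracket_entries\<close>)
    have face: "C (hochschild_face (Suc i) ?r) = (-1) ^ (n - 1) *\<^sub>R C (hochschild_face i as)"
      if i: "i < n" for i
    proof -
      have "hochschild_face (Suc i) ?r = rotate (n - 1) (hochschild_face i as)"
      proof (rule nth_equalityI)
        fix k assume "k < length (hochschild_face (Suc i) ?r)"
        then have k: "k < n" using i n by (simp add: length_hochschild_face)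
        have "rotate (n - 1) (hochschild_face i as) ! k =
            hochschild_face i as ! (if k = 0 then n - 1 else k - 1)"
          using k n i cyclic_predecessor[of k n] by (simp add: nth_rotate length_hochschild_face)
        moreover have "hochschild_face (Suc i) ?r ! k =
            hochschild_face i as ! (if k = 0 then n - 1 else k - 1)"
        proof (cases "Suc i = n")
          case True
          then have "n - Suc 0 = i" by simp
          with True show ?thesis
            using k n i by (cases k) (simp_all add: hochschild_face_def nth_bracket_entries r)
        next
          case False
          consider "k = 0" | "k = Suc i" | "0 < k" "k < Suc i" | "Suc i < k" by linarith
          then show ?thesis
            using k n i False by cases (simp_all add: hochschild_face_def nth_bracket_entries r, (intro conjI impI; linarith)+)
        qed
        ultimately show "hochschild_face (Suc i) ?r ! k = rotate (n - 1) (hochschild_face i as) ! k"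
          by (simp only:)
      qed (use i n in \<open>simp add: length_hochschild_face\<close>)
      then have "cyclic_operator (tensor_of (hochschild_face i as)) =
          (-1) ^ (n - 1) *\<^sub>R tensor_of (hochschild_face (Suc i) ?r)"
        using i n by (simp add: cyclic_operator_tensor_of length_hochschild_face)
      then have "C (hochschild_face i as) = (-1) ^ (n - 1) *\<^sub>R C (hochschild_face (Suc i) ?r)"
        unfolding C_def using abs_cyclic_operator linear_scale[OF linear_abs_cyclic] by metis
      then show ?thesis by simp
    qed
    have sign: "(-1) ^ n * ((-1) ^ Suc i * (-1) ^ (n - 1)) = ((-1) ^ i :: real)" for i
    proof -
      have "(-1) ^ n * ((-1) ^ Suc i * (-1) ^ (n - 1)) = ((-1) ^ n * (-1) ^ Suc (n - 1)) * ((-1) ^ i :: real)"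
        by simp
      also have "(-1) ^ n * (-1) ^ Suc (n - 1) = (1 :: real)"
        using n(2) by (simp flip: power_mult_distrib)
      finally show ?thesis by simp
    qed
    have lin: "abs_cyclic_tensor (hochschild_sum xs) = (\<Sum>i<length xs. (-1) ^ i *\<^sub>R C (hochschild_face i xs))"
      if "length xs > 1" for xs :: "'a list"
      using that by (simp add: hochschild_sum_def C_def linear_sum[OF linear_abs_cyclic]
          linear_scale[OF linear_abs_cyclic])
    have "abs_cyclic_tensor (hochschild_boundary (cyclic_operator (tensor_of as))) =
        (-1) ^ n *\<^sub>R (\<Sum>i<Suc n. (-1) ^ i *\<^sub>R C (hochschild_face i ?r))"
      using n by (simp add: cyclic_operator_tensor_of linear_scale[OF linear_hochschild_boundary]
          hochschild_boundary_tensor_of linear_scale[OF linear_abs_cyclic] lin del: sum.lessThan_Suc)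
    also have "\<dots> = (-1) ^ n *\<^sub>R C (hochschild_face n as) +
        (\<Sum>i<n. (-1) ^ n *\<^sub>R (-1) ^ Suc i *\<^sub>R C (hochschild_face (Suc i) ?r))"
      by (subst sum.lessThan_Suc_shift) (simp add: first scaleR_add_right scaleR_diff_right scaleR_sum_right sum_negf)
    also have "(\<Sum>i<n. (-1) ^ n *\<^sub>R (-1) ^ Suc i *\<^sub>R C (hochschild_face (Suc i) ?r)) =
        (\<Sum>i<n. (-1) ^ i *\<^sub>R C (hochschild_face i as))"
      by (rule sum.cong[OF refl]) (simp only: lessThan_iff face scaleR_scaleR sign)
    also have "(-1) ^ n *\<^sub>R C (hochschild_face n as) + \<dots> = abs_cyclic_tensor (hochschild_boundary (tensor_of as))"
      using n by (simp add: hochschild_boundary_tensor_of lin)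
    finally show ?thesis .
  qed
qed

lemma boundary_cyclic_abs:
  "boundary cyclic_complex (abs_cyclic_tensor t) = abs_cyclic_tensor (hochschild_boundary t)"
  unfolding cyclic_complex_def chain_cx.simps
proof (rule abs_cyclic_lift[of "\<lambda>t. abs_cyclic_tensor (hochschild_boundary t)"])
  show "linear (\<lambda>t::'a tensor. abs_cyclic_tensor (hochschild_boundary t))"
    using linear_compose[OF linear_hochschild_boundary linear_abs_cyclic] by (simp add: o_def)
qed (rule abs_cyclic_hochschild_cyclic abs_rep_cyclic)+

lemma linear_boundary_cyclic: "linear (boundary cyclic_complex)"
proof (rule linearI)
  fix v w :: "'a cyclic_tensor" and c :: real
  obtain s t where "v = abs_cyclic_tensor s" "w = abs_cyclic_tensor t" by (metis abs_rep_cyclic)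
  then show "boundary cyclic_complex (v + w) = boundary cyclic_complex v + boundary cyclic_complex w"
    "boundary cyclic_complex (c *\<^sub>R v) = c *\<^sub>R boundary cyclic_complex v"
    by (simp_all add: boundary_cyclic_abs plus_cyclic_tensor.abs_eq scaleR_cyclic_tensor.abs_eq
        linear_add[OF linear_hochschild_boundary] linear_scale[OF linear_hochschild_boundary])
qed

lemma complex_segment_cyclic: "complex_segment cyclic_complex 2"
proof (rule complex_segment.intro)
  have chains: "chains cyclic_complex n = abs_cyclic_tensor ` tensor_power (n + 1)" for n
    by (simp add: cyclic_complex_def)
  show "subspace (chains cyclic_complex 2 :: 'a cyclic_tensor set)"
    "subspace (chains cyclic_complex (Suc 2) :: 'a cyclic_tensor set)"
    unfolding chains by (intro linear_subspace_image linear_abs_cyclic subspace_tensor_power)+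
  show "linear (boundary (cyclic_complex :: 'a cyclic_tensor chain_cx))" by (rule linear_boundary_cyclic)
  fix w :: "'a cyclic_tensor" assume "w \<in> chains cyclic_complex (Suc 2)"
  then obtain t where t: "w = abs_cyclic_tensor t" "t \<in> tensor_power 4"
    unfolding chains by auto
  have "hochschild_boundary t \<in> tensor_power 3"
    using t(2) by (intro hochschild_boundary_chains) simp
  then show "boundary cyclic_complex w \<in> chains cyclic_complex 2"
    "boundary cyclic_complex (boundary cyclic_complex w) = 0"
    using t by (simp_all add: chains boundary_cyclic_abs hochschild_boundary_boundary
        linear_0[OF linear_abs_cyclic])
qed

lemma segment_map_cyclic_projection: "segment_map hochschild_complex 2 cyclic_complex 2 abs_cyclic_tensor"
proof (intro segment_map.intro segment_map_axioms.intro complex_segment_hochschild complex_segment_cyclic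
    linear_abs_cyclic)
  fix w :: "'a tensor"
  show "boundary cyclic_complex (abs_cyclic_tensor w) = abs_cyclic_tensor (boundary hochschild_complex w)"
    by (simp add: boundary_cyclic_abs hochschild_complex_def)
qed (simp_all add: hochschild_complex_def cyclic_complex_def)

section \<open>Antisymmetrization\<close>

lemma lie_product_commutator: "lie_product (commutator :: 'a::real_algebra_1 \<Rightarrow> 'a \<Rightarrow> 'a)"
proof (intro lie_product.intro lie_product_axioms.intro bilinear_product.intro linearI)
qed (simp_all add: commutator_def algebra_simps)

definition signed_rearrangement :: "'a::real_vector list \<Rightarrow> (nat \<Rightarrow> nat) \<Rightarrow> 'a tensor" where
  "signed_rearrangement as \<tau> = of_int (sign \<tau>) *\<^sub>R tensor_of (map (\<lambda>i. as ! \<tau> i) [0..<length as])"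

text \<open>The definition rearranges the entries by the inverses of the permutations, which have the same
  signs.\<close>

lemma antisymmetrize_eq:
  assumes "as \<noteq> []"
  shows "antisymmetrize as = (\<Sum>\<tau> | \<tau> permutes {1..<length as}. signed_rearrangement as \<tau>)"
proof -
  have n: "length as - 1 + 1 = length as" "{1..length as - 1} = {1..<length as}"
    using assms by (cases as; auto)+
  have "as ! 0 # map (\<lambda>i. as ! \<tau> i) [1..<length as] = map (\<lambda>i. as ! \<tau> i) [0..<length as]"
    if "\<tau> permutes {1..<length as}" for \<tau>
    using permutes_not_in[OF that, of 0] assms by (simp add: upt_conv_Cons)
  then show ?thesis
    unfolding antisymmetrize_def Let_def n
    by (subst sum_permutations_inverse)
      (auto simp: signed_rearrangement_def permutes_inv_inv
        intro!: sum.cong sign_inverse permutes_imp_permutation[of "{1..<length as}"])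
qed

lemma multilinear_antisymmetrize: "multilinear antisymmetrize"
  unfolding multilinear_iff_at
proof
  fix zs :: "'a list"
  show "multilinear_at antisymmetrize zs"
  proof (cases "zs = []")
    case False
    have "multilinear_at (\<lambda>as. of_int (sign \<tau>) *\<^sub>R tensor_of (map (\<lambda>i. as ! \<tau> i) [0..<length as])) zs"
      if "\<tau> permutes {1..<length zs}" for \<tau>
      by (rule multilinear_at_scaleR)
        (intro multilinear_at_permuted_entries multilinear_tensor_of permutes_subset[OF that], auto)
    then have "multilinear_at (\<lambda>as. \<Sum>\<tau> | \<tau> permutes {1..<length as}. signed_rearrangement as \<tau>) zs"
      unfolding signed_rearrangement_def by (intro multilinear_at_sum) simp
    moreover have "multilinear_at antisymmetrize zs \<longleftrightarrow>
        multilinear_at (\<lambda>as. \<Sum>\<tau> | \<tau> permutes {1..<length as}. signed_rearrangement as \<tau>) zs"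
      using False by (intro multilinear_at_cong) (metis antisymmetrize_eq length_0_conv)
    ultimately show ?thesis by simp
  qed (simp add: multilinear_at_def)
qed

lemma linear_phi_chain: "linear phi_chain"
  unfolding phi_chain_def by (rule linear_tensor_lift[OF multilinear_antisymmetrize])

lemma phi_chain_tensor_of: "phi_chain (tensor_of as) = antisymmetrize as"
  unfolding phi_chain_def by (rule tensor_lift_tensor_of[OF multilinear_antisymmetrize])

lemma phi_chain_chains:
  assumes "t \<in> tensor_power (Suc n)" shows "phi_chain t \<in> tensor_power (Suc n)"
  unfolding phi_chain_def
proof (rule tensor_lift_mem[OF multilinear_antisymmetrize subspace_tensor_power _ assms])
  fix xs :: "'a list" assume "length xs = Suc n"
  then show "antisymmetrize xs \<in> tensor_power (Suc n)"
    by (subst antisymmetrize_eq)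
      (auto simp: signed_rearrangement_def
        intro!: subspace_sum subspace_tensor_power subspace_scale tensor_of_mem_tensor_power)
qed

definition cyclic_shift :: "nat \<Rightarrow> nat \<Rightarrow> nat"
  where "cyclic_shift N i = (if i < N then Suc i mod N else i)"

text \<open>A cycle of length \<open>n + 2\<close> is a cycle of length \<open>n + 1\<close> followed by a transposition; this gives the
  sign by induction.\<close>

lemma cyclic_shift_Suc: "cyclic_shift (Suc (Suc n)) = transpose 0 (Suc n) \<circ> cyclic_shift (Suc n)"
  by (auto simp: cyclic_shift_def transpose_def fun_eq_iff mod_Suc)

lemma cyclic_shift_permutes: "cyclic_shift N permutes {..<N}"
proof (cases N)
  case (Suc n)
  have "cyclic_shift (Suc n) permutes {..<Suc n}"
  proof (induction n)
    case 0
    have "cyclic_shift (Suc 0) = id" by (auto simp: cyclic_shift_def fun_eq_iff)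
    then show ?case by (simp only: permutes_id)
  next
    case (Suc n)
    show ?case
      unfolding cyclic_shift_Suc
      by (rule permutes_compose[OF permutes_subset[OF Suc] permutes_swap_id]) auto
  qed
  then show ?thesis by (simp add: Suc)
qed (auto simp: cyclic_shift_def permutes_def)

lemma sign_cyclic_shift: "sign (cyclic_shift (Suc n)) = (-1) ^ n"
proof (induction n)
  case 0
  have "cyclic_shift (Suc 0) = id" by (auto simp: cyclic_shift_def fun_eq_iff)
  then show ?case by simp
next
  case (Suc n)
  have "permutation (cyclic_shift (Suc n))"
    using cyclic_shift_permutes permutation_permutes by blast
  then show ?case
    unfolding cyclic_shift_Suc by (subst sign_compose) (simp_all add: permutation_swap_id sign_swap_id Suc)
qed

lemma cyclic_shift_pow: "i < N \<Longrightarrow> (cyclic_shift N ^^ k) i = (i + k) mod N"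
  by (induction k) (auto simp: cyclic_shift_def mod_Suc_eq)

lemma cyclic_shift_pow_permutes: "cyclic_shift N ^^ k permutes {..<N}"
proof (induction k)
  case (Suc k)
  show ?case unfolding funpow.simps by (rule permutes_compose[OF Suc cyclic_shift_permutes])
qed (simp only: funpow.simps permutes_id)

text \<open>Rotating the positions multiplies the sign of the permutation by \<open>(-1)\<^sup>n\<close>, which is the sign that
  the cyclic operator attaches to the rotation of the tensor.\<close>

lemma abs_cyclic_signed_rearrangement_shift:
  assumes "\<tau> permutes {..<length as}"
  shows "abs_cyclic_tensor (signed_rearrangement as (\<tau> \<circ> cyclic_shift (length as) ^^ k)) =
    abs_cyclic_tensor (signed_rearrangement as \<tau>)"
proof (induction k)
  case (Suc k)
  let ?c = "cyclic_shift (length as)" and ?\<rho> = "\<tau> \<circ> cyclic_shift (length as) ^^ k"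
  show ?case
  proof (cases as)
    case (Cons a bs)
    let ?n = "length bs" and ?L = "\<lambda>\<tau>. map (\<lambda>i. as ! \<tau> i) [0..<length as]"
    have n: "length as = Suc ?n" by (simp add: Cons)
    have "permutation ?\<rho>"
      using permutes_compose[OF cyclic_shift_pow_permutes assms] permutation_permutes by blast
    moreover have "permutation ?c"
      using cyclic_shift_permutes permutation_permutes by blast
    ultimately have sign: "sign (?\<rho> \<circ> ?c) = sign ?\<rho> * (-1) ^ ?n"
      by (simp add: sign_compose sign_cyclic_shift n del: comp_apply)
    have "?L ?\<rho> = rotate ?n (?L (?\<rho> \<circ> ?c))"
    proof (rule nth_equalityI)
      fix i assume "i < length (?L ?\<rho>)"
      then have i: "i < Suc ?n" by (simp add: n)
      have "?c ((?n + i) mod Suc ?n) = i"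
        using i cyclic_predecessor[OF i] by (auto simp: cyclic_shift_def n)
      then show "?L ?\<rho> ! i = rotate ?n (?L (?\<rho> \<circ> ?c)) ! i"
        using i by (simp add: nth_rotate n del: upt_Suc)
    qed simp
    then have "abs_cyclic_tensor (tensor_of (?L (?\<rho> \<circ> ?c))) = (-1) ^ ?n *\<^sub>R abs_cyclic_tensor (tensor_of (?L ?\<rho>))"
      using abs_cyclic_operator[of "tensor_of (?L (?\<rho> \<circ> ?c))"]
      by (simp add: cyclic_operator_tensor_of linear_scale[OF linear_abs_cyclic] n)
    then have "abs_cyclic_tensor (signed_rearrangement as (?\<rho> \<circ> ?c)) =
        abs_cyclic_tensor (signed_rearrangement as ?\<rho>)"
      unfolding signed_rearrangement_def sign
      by (simp add: linear_scale[OF linear_abs_cyclic] flip: power_add mult_2)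
    moreover have "\<tau> \<circ> ?c ^^ Suc k = ?\<rho> \<circ> ?c"
      by (simp only: funpow_Suc_right o_assoc)
    ultimately show ?thesis by (simp only: Suc)
  next
    case Nil
    then have "?c = id" by (auto simp: cyclic_shift_def fun_eq_iff)
    then show ?thesis by (simp only: id_funpow o_id)
  qed
qed simp

text \<open>If two adjacent entries agree, exchanging them changes only the sign of a rearrangement. When one
  of the two is the first entry, the exchanged rearrangement no longer starts with entry \<open>0\<close>; in the
  cyclic quotient it may be rotated until it does. Exchange followed by this rotation permutes the
  summands and reverses their signs, so the sum is its own negative.\<close>

lemma alternating_abs_cyclic_antisymmetrize: "alternating (\<lambda>as. abs_cyclic_tensor (antisymmetrize as))"
  unfolding alternating_iff_adjacent
proof (intro conjI allI impI)
  show "multilinear (\<lambda>as. abs_cyclic_tensor (antisymmetrize as))"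
    by (rule multilinear_compose[OF linear_abs_cyclic multilinear_antisymmetrize])
next
  fix zs :: "'a list" and p
  assume p: "Suc p < length zs" and eq: "zs ! p = zs ! Suc p"
  let ?N = "length zs" and ?s = "transpose p (Suc p)"
  let ?P = "{\<tau>. \<tau> permutes {1..<?N}}" and ?c = "cyclic_shift ?N"
  define F where "F \<tau> = abs_cyclic_tensor (signed_rearrangement zs \<tau>)" for \<tau>
  \<comment> \<open>the position to which the exchange moves entry \<open>0\<close>\<close>
  define k where "k \<tau> = Hilbert_Choice.inv \<tau> (?s 0)" for \<tau> :: "nat \<Rightarrow> nat"
  define g where "g \<tau> = (?s \<circ> \<tau>) \<circ> ?c ^^ k \<tau>" for \<tau>
  have all: "\<tau> permutes {..<?N}" if "\<tau> \<in> ?P" for \<tau>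
    using that by (auto intro: permutes_subset)
  have pos: "0 < ?N" using p by linarith
  have s: "?s permutes {..<?N}" using p by (intro permutes_swap_id) auto
  have s\<tau>: "?s \<circ> \<tau> permutes {..<?N}" if "\<tau> \<in> ?P" for \<tau>
    by (rule permutes_compose[OF all[OF that] s])
  have k: "k \<tau> < ?N" if "\<tau> \<in> ?P" for \<tau>
    using permutes_in_image[OF permutes_inv[OF all[OF that]], of "?s 0"] permutes_in_image[OF s, of 0] p
    by (auto simp: k_def)
  have swap: "F (?s \<circ> \<tau>) = - F \<tau>" if "\<tau> \<in> ?P" for \<tau>
  proof -
    have "permutation \<tau>" using all[OF that] permutation_permutes by blast
    then have "sign (?s \<circ> \<tau>) = - sign \<tau>"
      by (simp add: sign_compose permutation_swap_id sign_swap_id)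
    moreover have "map (\<lambda>i. zs ! (?s \<circ> \<tau>) i) [0..<?N] = map (\<lambda>i. zs ! \<tau> i) [0..<?N]"
      using eq by (auto simp: transpose_def)
    ultimately show ?thesis
      unfolding F_def signed_rearrangement_def
      by (simp only: of_int_minus scaleR_minus_left linear_neg[OF linear_abs_cyclic])
  qed
  have F_g: "F (g \<tau>) = - F \<tau>" if "\<tau> \<in> ?P" for \<tau>
    unfolding g_def swap[OF that, symmetric] unfolding F_def
    by (rule abs_cyclic_signed_rearrangement_shift[OF s\<tau>[OF that]])
  have g_mem: "g \<tau> \<in> ?P" if "\<tau> \<in> ?P" for \<tau>
  proof -
    have "g \<tau> 0 = ?s (\<tau> (k \<tau>))"
      using k[OF that] cyclic_shift_pow[OF pos, of "k \<tau>"] by (simp add: g_def)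
    also have "\<dots> = 0" using permutes_inverses[OF all[OF that]] by (simp add: k_def)
    finally have "g \<tau> 0 = 0" .
    have "g \<tau> permutes {..<?N}"
      unfolding g_def by (rule permutes_compose[OF cyclic_shift_pow_permutes s\<tau>[OF that]])
    then have "g \<tau> permutes {1..<?N}"
    proof (rule permutes_superset)
      fix x assume "x \<in> {..<?N} - {1..<?N}"
      then have "x = 0" by auto
      with \<open>g \<tau> 0 = 0\<close> show "g \<tau> x = x" by simp
    qed
    then show ?thesis by simp
  qed
  have inj: "inj_on g ?P"
  proof (rule inj_onI)
    fix \<tau> \<tau>' assume \<tau>: "\<tau> \<in> ?P" "\<tau>' \<in> ?P" and eq_g: "g \<tau> = g \<tau>'"
    from fun_cong[OF eq_g] have "?s (\<tau> ((?c ^^ k \<tau>) i)) = ?s (\<tau>' ((?c ^^ k \<tau>') i))" for i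
      by (simp only: g_def comp_apply)
    then have e: "\<tau> ((?c ^^ k \<tau>) i) = \<tau>' ((?c ^^ k \<tau>') i)" for i
      by (rule injD[OF permutes_inj[OF s]])
    have fix0: "\<rho> i = 0 \<longleftrightarrow> i = 0" if "\<rho> \<in> ?P" for \<rho> i
    proof -
      have \<rho>: "\<rho> permutes {1..<?N}" using that by simp
      have "\<rho> 0 = 0" by (rule permutes_not_in[OF \<rho>]) simp
      then show ?thesis using injD[OF permutes_inj[OF \<rho>], of i 0] by auto
    qed
    define m where "m = (if k \<tau> = 0 then 0 else ?N - k \<tau>)"
    have m: "m < ?N" using pos by (auto simp: m_def)
    have wrap: "(m + j) mod ?N = (if m + j < ?N then m + j else m + j - ?N)" if "j < ?N" for j
      using m that by (auto simp: mod_if)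
    have "(?c ^^ k \<tau>) m = 0"
      unfolding cyclic_shift_pow[OF m] wrap[OF k[OF \<tau>(1)]]
      using k[OF \<tau>(1)] by (auto simp: m_def)
    then have "\<tau>' ((?c ^^ k \<tau>') m) = 0" using e[of m] fix0[OF \<tau>(1), of 0] by simp
    then have "(?c ^^ k \<tau>') m = 0" by (simp only: fix0[OF \<tau>(2)])
    then have "k \<tau> = k \<tau>'"
      unfolding cyclic_shift_pow[OF m] wrap[OF k[OF \<tau>(2)]]
      using k[OF \<tau>(1)] k[OF \<tau>(2)] by (auto simp: m_def split: if_splits)
    then have e': "\<tau> ((?c ^^ k \<tau>) i) = \<tau>' ((?c ^^ k \<tau>) i)" for i using e[of i] by simp
    show "\<tau> = \<tau>'"
    proof
      fix j
      obtain i where "j = (?c ^^ k \<tau>) i"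
        using surjD[OF permutes_surj[OF cyclic_shift_pow_permutes]] by blast
      then show "\<tau> j = \<tau>' j" using e' by simp
    qed
  qed
  have fin: "finite ?P" by (simp add: finite_permutations)
  have image: "g ` ?P = ?P" by (rule endo_inj_surj[OF fin _ inj]) (use g_mem in blast)
  have "sum F ?P = sum F (g ` ?P)" by (simp only: image)
  also have "\<dots> = (\<Sum>\<tau>\<in>?P. F (g \<tau>))" using sum.reindex[OF inj, of F] by (simp add: o_def)
  also have "\<dots> = - sum F ?P" by (simp add: F_g sum_negf)
  finally have "sum F ?P + sum F ?P = 0" by (simp add: eq_neg_iff_add_eq_0)
  then have "2 *\<^sub>R sum F ?P = 0" by (simp only: scaleR_2)
  then have "sum F ?P = 0" by simp
  moreover have "zs \<noteq> []" using p by auto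
  ultimately show "abs_cyclic_tensor (antisymmetrize zs) = 0"
    by (simp add: antisymmetrize_eq linear_sum[OF linear_abs_cyclic] F_def)
qed

lemma antisymmetrize_3: "antisymmetrize [a, b, c] = tensor_of [a, b, c] - tensor_of [a, c, b]"
proof -
  have "{1..<length [a, b, c]} = insert 1 {2}" by auto
  then have "antisymmetrize [a, b, c] =
      (\<Sum>\<tau> | \<tau> permutes insert 1 {2}. signed_rearrangement [a, b, c] \<tau>)"
    by (subst antisymmetrize_eq) (simp_all only: list.distinct not_False_eq_True)
  moreover have "signed_rearrangement [a, b, c] \<tau> =
      of_int (sign \<tau>) *\<^sub>R tensor_of [[a, b, c] ! \<tau> 0, [a, b, c] ! \<tau> 1, [a, b, c] ! \<tau> 2]" for \<tau>
    by (simp add: signed_rearrangement_def numeral_2_eq_2)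
  ultimately show ?thesis
    by (simp add: sum_over_permutations_insert permutes_sing sign_swap_id transpose_def del: One_nat_def)
qed

lemma antisymmetrize_4:
  "antisymmetrize [a, b, c, d] = tensor_of [a, b, c, d] - tensor_of [a, b, d, c]
     - tensor_of [a, c, b, d] + tensor_of [a, c, d, b] + tensor_of [a, d, b, c] - tensor_of [a, d, c, b]"
proof -
  have "{1..<length [a, b, c, d]} = insert 1 (insert 2 {3})" by auto
  then have "antisymmetrize [a, b, c, d] =
      (\<Sum>\<tau> | \<tau> permutes insert 1 (insert 2 {3}). signed_rearrangement [a, b, c, d] \<tau>)"
    by (subst antisymmetrize_eq) (simp_all only: list.distinct not_False_eq_True)
  moreover have "signed_rearrangement [a, b, c, d] \<tau> = of_int (sign \<tau>) *\<^sub>R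
      tensor_of [[a, b, c, d] ! \<tau> 0, [a, b, c, d] ! \<tau> 1, [a, b, c, d] ! \<tau> 2, [a, b, c, d] ! \<tau> 3]" for \<tau>
    by (simp add: signed_rearrangement_def numeral_2_eq_2 numeral_3_eq_3)
  ultimately show ?thesis
    by (simp add: sum_over_permutations_insert permutes_sing sign_swap_id sign_compose
        permutation_swap_id permutation_compose transpose_def del: One_nat_def)
qed

text \<open>Both sides are the signed sum, over all rearrangements fixing the first entry, of the tensors
  obtained by multiplying two cyclic neighbours. The two degrees treated are the ones that determine
  the map on homology in degree 3.\<close>

lemma phi_chain_boundary:
  fixes t :: "'a::real_algebra_1 tensor"
  assumes "t \<in> tensor_power 3 \<or> t \<in> tensor_power 4"
  shows "hochschild_boundary (phi_chain t) = phi_chain (boundary (leibniz_complex commutator) t)"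
proof -
  interpret lie_product "commutator :: 'a \<Rightarrow> 'a \<Rightarrow> 'a" by (rule lie_product_commutator)
  note lin = linear_add[OF linear_hochschild_boundary] linear_diff[OF linear_hochschild_boundary]
    linear_add[OF linear_phi_chain] linear_diff[OF linear_phi_chain]
  have two: "antisymmetrize [a, b] = tensor_of [a, b]" for a b :: 'a
    by (subst antisymmetrize_eq) (simp_all add: signed_rearrangement_def permutes_sing eval_nat_numeral)
  have left: "linear (\<lambda>t :: 'a tensor. hochschild_boundary (phi_chain t))"
    "linear (\<lambda>t :: 'a tensor. phi_chain (boundary (leibniz_complex commutator) t))"
    by (rule linear_compose[OF linear_phi_chain linear_hochschild_boundary, unfolded o_def]
        linear_compose[OF linear_boundary_leibniz linear_phi_chain, unfolded o_def])+
  show ?thesis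
  proof (use assms in \<open>elim disjE\<close>)
    assume "t \<in> tensor_power 3"
    then show ?thesis
    proof (rule tensor_power_eqI[OF _ left])
      fix xs :: "'a list" assume "length xs = 3"
      then obtain a b c where "xs = [a, b, c]" by (auto simp: length_3_conv)
      then show "hochschild_boundary (phi_chain (tensor_of xs)) =
          phi_chain (boundary (leibniz_complex commutator) (tensor_of xs))"
        by (simp add: phi_chain_tensor_of antisymmetrize_3 lin hochschild_boundary_tensor_of
            hochschild_sum_3 boundary_leibniz_tensor_of leibniz_sum_3 two commutator_def
            linear_diff[OF linear_tensor_of_2(1)] linear_diff[OF linear_tensor_of_2(2)])
    qed
  next
    assume "t \<in> tensor_power 4"
    then show ?thesis
    proof (rule tensor_power_eqI[OF _ left])
      fix xs :: "'a list" assume "length xs = 4"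
      then obtain a b c d where "xs = [a, b, c, d]" by (auto simp: length_4_conv)
      then show "hochschild_boundary (phi_chain (tensor_of xs)) =
          phi_chain (boundary (leibniz_complex commutator) (tensor_of xs))"
        by (simp add: phi_chain_tensor_of antisymmetrize_4 antisymmetrize_3 lin hochschild_boundary_tensor_of
            hochschild_sum_4 boundary_leibniz_tensor_of leibniz_sum_4 commutator_def
            linear_diff[OF linear_tensor_of_3(1)] linear_diff[OF linear_tensor_of_3(2)]
            linear_diff[OF linear_tensor_of_3(3)])
    qed
  qed
qed

lemma segment_map_phi:
  "segment_map (leibniz_complex (commutator :: 'a::real_algebra_1 \<Rightarrow> 'a \<Rightarrow> 'a)) 3 hochschild_complex 2 phi_chain"
proof -
  interpret lie_product "commutator :: 'a \<Rightarrow> 'a \<Rightarrow> 'a" by (rule lie_product_commutator)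
  show ?thesis
  proof (intro segment_map.intro segment_map_axioms.intro complex_segment_leibniz
      complex_segment_hochschild linear_phi_chain)
    fix w :: "'a tensor"
    assume "w \<in> chains (leibniz_complex commutator) 3 \<or> w \<in> chains (leibniz_complex commutator) (Suc 3)"
    then show "boundary hochschild_complex (phi_chain w) = phi_chain (boundary (leibniz_complex commutator) w)"
      using phi_chain_boundary[of w] by (simp add: leibniz_complex_def hochschild_complex_def)
  qed (use phi_chain_chains[of _ 2] phi_chain_chains[of _ 3] in
      \<open>simp_all add: leibniz_complex_def hochschild_complex_def\<close>)
qed

lemma theta_chain_abs: "theta_chain (abs_exterior t) = abs_cyclic_tensor (phi_chain t)"
proof -
  have "theta_chain (abs_exterior t) = tensor_lift (\<lambda>as. abs_cyclic_tensor (antisymmetrize as)) t"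
    unfolding theta_chain_def by (rule exterior_lift_abs[OF alternating_abs_cyclic_antisymmetrize])
  also have "\<dots> = abs_cyclic_tensor (phi_chain t)"
  proof (rule tensor_linear_eqI[of "tensor_lift (\<lambda>as. abs_cyclic_tensor (antisymmetrize as))"
        "\<lambda>t. abs_cyclic_tensor (phi_chain t)"])
    have m: "multilinear (\<lambda>as::'a list. abs_cyclic_tensor (antisymmetrize as))"
      by (rule multilinear_compose[OF linear_abs_cyclic multilinear_antisymmetrize])
    show "linear (tensor_lift (\<lambda>as::'a list. abs_cyclic_tensor (antisymmetrize as)))"
      by (rule linear_tensor_lift[OF m])
    show "linear (\<lambda>t::'a tensor. abs_cyclic_tensor (phi_chain t))"
      using linear_compose[OF linear_phi_chain linear_abs_cyclic] by (simp add: o_def)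
    show "tensor_lift (\<lambda>as. abs_cyclic_tensor (antisymmetrize as)) (tensor_of xs) =
        abs_cyclic_tensor (phi_chain (tensor_of xs))" for xs :: "'a list"
      by (simp add: tensor_lift_tensor_of[OF m] phi_chain_tensor_of)
  qed
  finally show ?thesis .
qed

lemma segment_map_theta:
  "segment_map (lie_complex (commutator :: 'a::real_algebra_1 \<Rightarrow> 'a \<Rightarrow> 'a)) 3 cyclic_complex 2 theta_chain"
proof -
  interpret lie_product "commutator :: 'a \<Rightarrow> 'a \<Rightarrow> 'a" by (rule lie_product_commutator)
  show ?thesis
  proof (intro segment_map.intro segment_map_axioms.intro complex_segment_lie complex_segment_cyclic)
    show "linear (theta_chain :: 'a exterior \<Rightarrow> _)"
      unfolding theta_chain_def by (rule linear_exterior_lift[OF alternating_abs_cyclic_antisymmetrize])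
    fix w :: "'a exterior"
    assume "w \<in> chains (lie_complex commutator) 3 \<or> w \<in> chains (lie_complex commutator) (Suc 3)"
    then obtain t where "w = abs_exterior t" "t \<in> tensor_power 3 \<or> t \<in> tensor_power 4"
      by (auto simp: lie_complex_def exterior_power_def)
    then show "boundary cyclic_complex (theta_chain w) = theta_chain (boundary (lie_complex commutator) w)"
      by (simp add: theta_chain_abs boundary_lie_abs_exterior boundary_cyclic_abs phi_chain_boundary)
  next
    have image: "theta_chain w \<in> abs_cyclic_tensor ` tensor_power (Suc n)"
      if w: "w \<in> abs_exterior ` tensor_power (Suc n)" for w :: "'a exterior" and n
    proof -
      obtain t where "w = abs_exterior t" "t \<in> tensor_power (Suc n)" using w by blast
      then show ?thesis by (simp only: theta_chain_abs imageI phi_chain_chains)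
    qed
    show "theta_chain w \<in> chains cyclic_complex 2" if "w \<in> chains (lie_complex commutator) 3"
      for w :: "'a exterior"
      using that image[of w 2] by (simp add: lie_complex_def exterior_power_def cyclic_complex_def)
    show "theta_chain w \<in> chains cyclic_complex (Suc 2)" if "w \<in> chains (lie_complex commutator) (Suc 3)"
      for w :: "'a exterior"
      using that image[of w 3] by (simp add: lie_complex_def exterior_power_def cyclic_complex_def)
  qed
qed

section \<open>Modules over the universal enveloping algebra\<close>

lemma linear_abs_uea: "linear abs_uea"
  by (rule linearI) (simp_all add: plus_uea.abs_eq scaleR_uea.abs_eq)

lemma abs_rep_uea: "abs_uea (rep_uea u) = u"
  by (rule Quotient_abs_rep[OF Quotient_uea])

definition uea_word :: "'g::lie_algebra list \<Rightarrow> 'g uea"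
  where "uea_word xs = abs_uea (tensor_of xs)"

lemma uea_word_append: "uea_word (xs @ ys) = uea_word xs * uea_word ys"
  by (simp add: uea_word_def times_uea.abs_eq times_tensor_of)

lemma uea_linear_eqI:
  assumes "linear f" "linear g" "\<And>xs. f (uea_word xs) = g (uea_word xs)"
  shows "f u = g u"
proof -
  have "f (abs_uea (rep_uea u)) = g (abs_uea (rep_uea u))"
  proof (rule tensor_linear_eqI[of "\<lambda>t. f (abs_uea t)" "\<lambda>t. g (abs_uea t)"])
    show "linear (\<lambda>t. f (abs_uea t))" "linear (\<lambda>t. g (abs_uea t))"
      using linear_compose[OF linear_abs_uea assms(1)] linear_compose[OF linear_abs_uea assms(2)]
      by (simp_all add: o_def)
  qed (use assms(3) in \<open>simp add: uea_word_def\<close>)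
  then show ?thesis by (simp add: abs_rep_uea)
qed

lemma linear_uea_inclusion: "linear uea_inclusion"
proof -
  have "linear (\<lambda>x. tensor_of ([] @ x # []))"
    using multilinear_tensor_of unfolding multilinear_def by blast
  from linear_compose[OF this linear_abs_uea] show ?thesis
    by (simp add: o_def uea_inclusion_def[abs_def])
qed

lemma uea_inclusion_bracket:
  "uea_inclusion (lie_bracket x y) = commutator (uea_inclusion x) (uea_inclusion y)"
proof -
  have "tensor_of [x, y] - tensor_of [y, x] - tensor_of [lie_bracket x y] \<in> enveloping_relations"
    by (auto simp: enveloping_relations_def)
  from multiplesI[OF this, of 1 1]
  have "tensor_of [x, y] - tensor_of [y, x] - tensor_of [lie_bracket x y] \<in> span (multiples enveloping_relations)"
    by (simp add: span_base)
  then have "abs_uea (tensor_of [x, y] - tensor_of [y, x]) = abs_uea (tensor_of [lie_bracket x y])"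
    by (simp add: uea.abs_eq_iff)
  then show ?thesis
    by (simp add: commutator_def uea_inclusion_def times_uea.abs_eq times_tensor_of linear_diff[OF linear_abs_uea])
qed

text \<open>A module of a Lie algebra becomes a module of the enveloping algebra by letting words act one
  letter at a time.\<close>

locale lie_module =
  fixes act :: "'g::lie_algebra \<Rightarrow> 'v::real_vector \<Rightarrow> 'v"
  assumes linear_act_left: "linear (\<lambda>x. act x v)" and linear_act_right: "linear (act x)"
    and act_bracket: "act (lie_bracket x y) v = act x (act y v) - act y (act x v)"
begin

lemma linear_foldr_act: "linear (foldr act xs)"
proof (induction xs)
  case Nil
  then show ?case using linear_id by (simp add: id_def)
next
  case (Cons x xs)
  show ?case using linear_compose[OF Cons linear_act_right[of x]] by (simp add: o_def)
qed

lemma multilinear_foldr_act: "multilinear (\<lambda>xs. foldr act xs v)"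
  unfolding multilinear_def
proof (intro allI)
  fix xs ys
  show "linear (\<lambda>x. foldr act (xs @ x # ys) v)"
    using linear_compose[OF linear_act_left[of "foldr act ys v"] linear_foldr_act[of xs]]
    by (simp add: o_def)
qed

definition uact :: "'g uea \<Rightarrow> 'v \<Rightarrow> 'v"
  where "uact u v = tensor_lift (\<lambda>xs. foldr act xs v) (rep_uea u)"

lemma tensor_lift_enveloping_relation:
  assumes "r \<in> multiples enveloping_relations"
  shows "tensor_lift (\<lambda>xs. foldr act xs v) r = 0"
proof -
  let ?f = "tensor_lift (\<lambda>xs. foldr act xs v)"
  note lin = linear_tensor_lift[OF multilinear_foldr_act[of v]]
  obtain a b x y where r: "r = a * (tensor_of [x, y] - tensor_of [y, x] - tensor_of [lie_bracket x y]) * b"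
    using assms by (auto simp: multiples_def enveloping_relations_def)
  let ?r = "tensor_of [x, y] - tensor_of [y, x] - tensor_of [lie_bracket x y]"
  have words: "?f (tensor_of xs * ?r * tensor_of ys) = 0" for xs ys
    by (simp add: left_diff_distrib right_diff_distrib times_tensor_of linear_diff[OF lin]
        tensor_lift_tensor_of[OF multilinear_foldr_act] act_bracket linear_diff[OF linear_foldr_act])
  have left: "?f (tensor_of xs * ?r * b) = 0" for xs
  proof (rule tensor_linear_eqI[of "\<lambda>b. ?f (tensor_of xs * ?r * b)" "\<lambda>_. 0"])
    show "linear (\<lambda>b. ?f (tensor_of xs * ?r * b))"
      using linear_compose[OF linear_times_right lin] by (simp add: o_def)
  qed (simp_all add: module_hom_zero words)
  have "?f (a * ?r * b) = 0"
  proof (rule tensor_linear_eqI[of "\<lambda>a. ?f (a * ?r * b)" "\<lambda>_. 0"])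
    show "linear (\<lambda>a. ?f (a * ?r * b))"
      using linear_compose[OF linear_compose[OF linear_times_left linear_times_left] lin]
      by (simp add: o_def)
  qed (simp_all add: module_hom_zero left)
  then show ?thesis by (simp add: r)
qed

lemma uact_abs: "uact (abs_uea t) v = tensor_lift (\<lambda>xs. foldr act xs v) t"
  unfolding uact_def
  by (rule linear_eq_mod_span[OF linear_tensor_lift[OF multilinear_foldr_act]
        tensor_lift_enveloping_relation rep_abs_mod_span[OF Quotient_uea]])

lemma uact_word: "uact (uea_word xs) v = foldr act xs v"
  by (simp add: uea_word_def uact_abs tensor_lift_tensor_of[OF multilinear_foldr_act])

lemma uact_inclusion: "uact (uea_inclusion x) v = act x v"
  using uact_word[of "[x]"] by (simp add: uea_word_def uea_inclusion_def)

lemma linear_uact_left: "linear (\<lambda>u. uact u v)"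
proof (rule linearI)
  note lin = linear_tensor_lift[OF multilinear_foldr_act[of v]]
  fix u w :: "'g uea" and c
  obtain s t where "u = abs_uea s" "w = abs_uea t" by (metis abs_rep_uea)
  then show "uact (u + w) v = uact u v + uact w v" "uact (c *\<^sub>R u) v = c *\<^sub>R uact u v"
    by (simp_all add: plus_uea.abs_eq scaleR_uea.abs_eq uact_abs linear_add[OF lin] linear_scale[OF lin])
qed

lemma linear_uact_right: "linear (uact u)"
proof (rule linearI)
  fix v w :: 'v and c
  note lin = linear_uact_left
  show "uact u (v + w) = uact u v + uact u w"
    by (rule uea_linear_eqI[of "\<lambda>u. uact u (v + w)" "\<lambda>u. uact u v + uact u w"])
      (auto simp: uact_word linear_add[OF linear_foldr_act] intro: lin linear_compose_add)
  show "uact u (c *\<^sub>R v) = c *\<^sub>R uact u v"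
    by (rule uea_linear_eqI[of "\<lambda>u. uact u (c *\<^sub>R v)" "\<lambda>u. c *\<^sub>R uact u v"])
      (auto simp: uact_word linear_scale[OF linear_foldr_act] intro: lin linear_compose_scale_right)
qed

lemma uact_times: "uact (u * w) v = uact u (uact w v)"
proof (rule uea_linear_eqI[of "\<lambda>u. uact (u * w) v" "\<lambda>u. uact u (uact w v)"])
  have times: "linear (\<lambda>u :: 'g uea. u * w)" "linear (\<lambda>w. u * w)" for u w :: "'g uea"
    by (intro linearI; simp add: algebra_simps)+
  show "linear (\<lambda>u. uact (u * w) v)"
    using linear_compose[OF times(1) linear_uact_left[of v]] by (simp add: o_def)
  show "linear (\<lambda>u. uact u (uact w v))" by (rule linear_uact_left)
  fix xs
  show "uact (uea_word xs * w) v = uact (uea_word xs) (uact w v)"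
  proof (rule uea_linear_eqI[of "\<lambda>w. uact (uea_word xs * w) v" "\<lambda>w. uact (uea_word xs) (uact w v)"])
    show "linear (\<lambda>w. uact (uea_word xs * w) v)"
      using linear_compose[OF times(2) linear_uact_left[of v]] by (simp add: o_def)
    show "linear (\<lambda>w. uact (uea_word xs) (uact w v))"
      using linear_compose[OF linear_uact_left linear_uact_right] by (simp add: o_def)
  qed (simp add: uact_word flip: uea_word_append)
qed

end

lemma uact_intertwine:
  assumes "lie_module act" "lie_module act'" "linear h" "\<And>x v. h (act x v) = act' x (h v)"
  shows "h (lie_module.uact act u v) = lie_module.uact act' u (h v)"
proof -
  interpret source: lie_module act by fact
  interpret target: lie_module act' by fact
  show ?thesis
  proof (rule uea_linear_eqI[of "\<lambda>u. h (source.uact u v)" "\<lambda>u. target.uact u (h v)"])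
    show "linear (\<lambda>u. h (source.uact u v))"
      using linear_compose[OF source.linear_uact_left assms(3)] by (simp add: o_def)
    show "linear (\<lambda>u. target.uact u (h v))" by (rule target.linear_uact_left)
    fix xs
    show "h (source.uact (uea_word xs) v) = target.uact (uea_word xs) (h v)"
      unfolding source.uact_word target.uact_word by (induction xs) (simp_all add: assms(4))
  qed
qed

text \<open>A 1-cocycle with values in \<open>Hom(B, A)\<close> is the off-diagonal entry of a module structure on
  \<open>A \<oplus> B\<close> that is upper triangular with the given actions on the diagonal. The enveloping algebra
  acts on this module by upper triangular matrices as well, and their off-diagonal entry extends the
  cocycle.\<close>

locale hom_cocycle =
  sub: lie_module actA + quot: lie_module actB
  for actA :: "'g::lie_algebra \<Rightarrow> 'a::real_vector \<Rightarrow> 'a" and actB :: "'g \<Rightarrow> 'b::real_vector \<Rightarrow> 'b" +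
  fixes c :: "'g \<Rightarrow> 'b \<Rightarrow> 'a"
  assumes linear_left: "linear (\<lambda>x. c x b)" and linear_right: "linear (c x)"
    and cocycle: "c (lie_bracket x y) b =
      actA x (c y b) + c x (actB y b) - (actA y (c x b) + c y (actB x b))"
begin

definition ext :: "'g \<Rightarrow> 'a \<times> 'b \<Rightarrow> 'a \<times> 'b"
  where "ext x p = (actA x (fst p) + c x (snd p), actB x (snd p))"

sublocale ext: lie_module ext
proof (rule lie_module.intro)
  note lin = linear_add[OF sub.linear_act_left] linear_add[OF sub.linear_act_right]
    linear_add[OF quot.linear_act_left] linear_add[OF quot.linear_act_right]
    linear_scale[OF sub.linear_act_left] linear_scale[OF sub.linear_act_right]
    linear_scale[OF quot.linear_act_left] linear_scale[OF quot.linear_act_right]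
    linear_add[OF linear_left] linear_add[OF linear_right]
    linear_scale[OF linear_left] linear_scale[OF linear_right]
  fix x y v
  show "linear (\<lambda>x. ext x v)" "linear (ext x)"
    by (intro linearI; simp add: ext_def lin scaleR_add_right)+
  show "ext (lie_bracket x y) v = ext x (ext y v) - ext y (ext x v)"
    by (simp add: ext_def lin sub.act_bracket quot.act_bracket cocycle)
qed

definition ucocycle :: "'g uea \<Rightarrow> 'b \<Rightarrow> 'a"
  where "ucocycle u b = fst (ext.uact u (0, b))"

text \<open>The triangular shape holds because the inclusion of \<open>A\<close> and the projection to \<open>B\<close> are module
  homomorphisms.\<close>

lemma uact_ext: "ext.uact u (a, b) = (sub.uact u a + ucocycle u b, quot.uact u b)"
proof -
  have inl: "linear (\<lambda>a. (a, 0 :: 'b))" and snd: "linear (snd :: 'a \<times> 'b \<Rightarrow> 'b)"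
    by (intro linearI; simp)+
  have "(sub.uact u a, 0) = ext.uact u (a, 0)"
    by (rule uact_intertwine[OF sub.lie_module_axioms ext.lie_module_axioms inl])
      (simp add: ext_def linear_0[OF linear_right] linear_0[OF quot.linear_act_right])
  moreover have "snd (ext.uact u (0, b)) = quot.uact u (snd (0 :: 'a, b))"
    by (rule uact_intertwine[OF ext.lie_module_axioms quot.lie_module_axioms snd]) (simp add: ext_def)
  moreover have "ext.uact u (a, b) = ext.uact u (a, 0) + ext.uact u (0, b)"
    using linear_add[OF ext.linear_uact_right, of u "(a, 0)" "(0, b)"] by simp
  ultimately show ?thesis by (simp add: ucocycle_def prod_eq_iff)
qed

text \<open>The off-diagonal entry of a product of triangular matrices.\<close>

lemma ucocycle_times: "ucocycle (u * w) b = sub.uact u (ucocycle w b) + ucocycle u (quot.uact w b)"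
proof -
  have "ucocycle (u * w) b = fst (ext.uact u (ext.uact w (0, b)))"
    by (simp add: ucocycle_def ext.uact_times)
  also have "\<dots> = sub.uact u (ucocycle w b) + ucocycle u (quot.uact w b)"
    by (simp add: uact_ext linear_0[OF sub.linear_uact_right])
  finally show ?thesis .
qed

lemma ucocycle_inclusion: "ucocycle (uea_inclusion x) b = c x b"
  by (simp add: ucocycle_def ext.uact_inclusion ext_def linear_0[OF sub.linear_act_right])

lemma linear_ucocycle_left: "linear (\<lambda>u. ucocycle u b)"
  using linear_compose[OF ext.linear_uact_left, of fst "(0, b)"] linear_fst
  by (simp add: o_def ucocycle_def)

lemma linear_ucocycle_right: "linear (ucocycle u)"
proof (rule linearI)
  fix b b' :: 'b and r
  show "ucocycle u (b + b') = ucocycle u b + ucocycle u b'"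
    using linear_add[OF ext.linear_uact_right, of u "(0, b)" "(0, b')"] by (simp add: ucocycle_def)
  show "ucocycle u (r *\<^sub>R b) = r *\<^sub>R ucocycle u b"
    using linear_scale[OF ext.linear_uact_right, of u r "(0, b)"] by (simp add: ucocycle_def)
qed

end

section \<open>Cyclic cocycles from cocycles with trivial coefficients\<close>

text \<open>A Hochschild 3-cocycle with values in the real numbers, on which the algebra acts through \<open>\<epsilon>\<close>
  from both sides.\<close>

locale trivial_coefficient_cocycle =
  fixes \<omega> :: "'a::real_algebra_1 \<Rightarrow> 'a \<Rightarrow> 'a \<Rightarrow> real" and \<epsilon> :: "'a \<Rightarrow> real"
  assumes linear_1: "linear (\<lambda>a. \<omega> a b c)"
    and linear_2: "linear (\<lambda>b. \<omega> a b c)"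
    and linear_3: "linear (\<omega> a b)"
    and cocycle: "\<omega> (a * b) c d - \<omega> a (b * c) d + \<omega> a b (c * d) = \<epsilon> a * \<omega> b c d + \<omega> a b c * \<epsilon> d"
begin

text \<open>For normalized \<open>\<omega>\<close> and \<open>\<epsilon>(1) = 1\<close> this is the dual of Connes' operator \<open>B\<close>, applied to
  \<open>(a, b, c, d) \<mapsto> \<epsilon>(a) \<omega>(b, c, d)\<close>.\<close>

definition cyclic_sum :: "'a list \<Rightarrow> real" where
  "cyclic_sum as = (if length as = 3
     then \<omega> (as ! 0) (as ! 1) (as ! 2) + \<omega> (as ! 2) (as ! 0) (as ! 1) + \<omega> (as ! 1) (as ! 2) (as ! 0)
     else 0)"

lemma multilinear_cyclic_sum: "multilinear cyclic_sum"
  unfolding multilinear_iff_at multilinear_at_def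
proof (intro allI impI)
  fix zs :: "'a list" and k assume k: "k < length zs"
  show "linear (\<lambda>x. cyclic_sum (zs[k := x]))"
  proof (cases "length zs = 3")
    case True
    then have "k = 0 \<or> k = 1 \<or> k = 2" using k by auto
    then show ?thesis
      using True linear_1 linear_2 linear_3 by (auto simp: cyclic_sum_def intro!: linear_compose_add)
  qed (simp add: cyclic_sum_def module_hom_zero)
qed

definition cyclic_functional :: "'a tensor \<Rightarrow> real"
  where "cyclic_functional = tensor_lift cyclic_sum"

lemma linear_cyclic_functional: "linear cyclic_functional"
  unfolding cyclic_functional_def by (rule linear_tensor_lift[OF multilinear_cyclic_sum])

lemma cyclic_functional_tensor_of: "cyclic_functional (tensor_of as) = cyclic_sum as"
  unfolding cyclic_functional_def by (rule tensor_lift_tensor_of[OF multilinear_cyclic_sum])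

lemma cyclic_functional_cyclic: "cyclic_functional (cyclic_operator t) = cyclic_functional t"
proof (rule tensor_linear_eqI[of "\<lambda>t. cyclic_functional (cyclic_operator t)" cyclic_functional])
  show "linear (\<lambda>t. cyclic_functional (cyclic_operator t))"
    using linear_compose[OF linear_cyclic_operator linear_cyclic_functional] by (simp add: o_def)
  fix xs :: "'a list"
  show "cyclic_functional (cyclic_operator (tensor_of xs)) = cyclic_functional (tensor_of xs)"
  proof (cases "length xs = 3")
    case True
    then obtain a b c where "xs = [a, b, c]" by (auto simp: length_3_conv)
    then show ?thesis
      by (simp add: cyclic_operator_tensor_of cyclic_functional_tensor_of cyclic_sum_def
          linear_scale[OF linear_cyclic_functional] numeral_2_eq_2)
  next
    case False
    then show ?thesis
      by (simp add: cyclic_operator_tensor_of cyclic_functional_tensor_of cyclic_sum_def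
          linear_scale[OF linear_cyclic_functional])
  qed
qed (rule linear_cyclic_functional)

text \<open>The value at the boundary of \<open>(a, b, c, d)\<close> is the alternating sum of the left-hand sides of the
  cocycle identity at the four rotations of \<open>(a, b, c, d)\<close>. In the corresponding sum of right-hand sides
  each term \<open>\<epsilon>(a) \<omega>(b, c, d)\<close> occurs once with either sign.\<close>

lemma cyclic_functional_hochschild_boundary: "cyclic_functional (hochschild_boundary t) = 0"
proof (rule tensor_linear_eqI[of "\<lambda>t. cyclic_functional (hochschild_boundary t)" "\<lambda>_. 0"])
  note lin = linear_cyclic_functional
  show "linear (\<lambda>t. cyclic_functional (hochschild_boundary t))"
    using linear_compose[OF linear_hochschild_boundary lin] by (simp add: o_def)
  fix xs :: "'a list"
  show "cyclic_functional (hochschild_boundary (tensor_of xs)) = 0"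
  proof (cases "length xs = 4")
    case True
    then obtain a b c d where xs: "xs = [a, b, c, d]" by (auto simp: length_4_conv)
    show ?thesis
      using cocycle[of a b c d] cocycle[of b c d a] cocycle[of c d a b] cocycle[of d a b c]
      by (simp add: xs hochschild_boundary_tensor_of hochschild_sum_4 linear_add[OF lin]
          linear_diff[OF lin] cyclic_functional_tensor_of cyclic_sum_def algebra_simps)
  next
    case False
    then show ?thesis
      by (auto simp: hochschild_boundary_tensor_of hochschild_sum_def linear_sum[OF lin]
          linear_scale[OF lin] linear_0[OF lin] cyclic_functional_tensor_of cyclic_sum_def
          length_hochschild_face simp del: sum.lessThan_Suc intro!: sum.neutral)
  qed
qed (simp add: module_hom_zero)

lemma cyclic_class_nonzero:
  assumes "cyclic_functional t \<noteq> 0"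
  shows "abs_cyclic_tensor t \<notin> boundaries cyclic_complex n"
proof
  assume "abs_cyclic_tensor t \<in> boundaries cyclic_complex n"
  then obtain s where "abs_cyclic_tensor t = boundary cyclic_complex (abs_cyclic_tensor s)"
    by (auto simp: boundaries_def cyclic_complex_def)
  then have "abs_cyclic_tensor t = abs_cyclic_tensor (hochschild_boundary s)"
    by (simp add: boundary_cyclic_abs)
  then have "cyclic_functional t = cyclic_functional (hochschild_boundary s)"
    by (rule abs_cyclic_lift[OF linear_cyclic_functional cyclic_functional_cyclic])
  then show False using assms by (simp add: cyclic_functional_hochschild_boundary)
qed

end

section \<open>One-forms on the line\<close>

instantiation poly :: ("{real_algebra_1, comm_ring_1}") real_vector
begin
definition scaleR_poly :: "real \<Rightarrow> 'a poly \<Rightarrow> 'a poly" where "scaleR_poly r p = smult (of_real r) p"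
instance
  by standard (simp_all add: scaleR_poly_def smult_add_left smult_add_right)
end

lemma scaleR_real_poly: "r *\<^sub>R p = smult r p" for p :: "real poly"
  by (simp add: scaleR_poly_def)

lemmas coefficient_simps = plus_poly_vector_field.rep_eq scaleR_poly_vector_field.rep_eq
  lie_bracket_poly_vector_field.rep_eq

text \<open>The polynomial \<open>p\<close> stands for the one-form \<open>p dx\<close>; Cartan's formula gives \<open>L\<^sub>f (p dx) = d(f p)\<close>.\<close>

definition lie_derivative :: "poly_vector_field \<Rightarrow> real poly \<Rightarrow> real poly"
  where "lie_derivative x p = pderiv (coefficient x * p)"

definition trivial_action :: "poly_vector_field \<Rightarrow> real \<Rightarrow> real"
  where "trivial_action x r = 0"

definition second_derivative_cocycle :: "poly_vector_field \<Rightarrow> real \<Rightarrow> real poly"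
  where "second_derivative_cocycle x r = smult r (pderiv (pderiv (coefficient x)))"

definition divergence_cocycle :: "poly_vector_field \<Rightarrow> real poly \<Rightarrow> real poly"
  where "divergence_cocycle x p = pderiv (coefficient x) * p"

definition evaluation_cocycle :: "poly_vector_field \<Rightarrow> real poly \<Rightarrow> real"
  where "evaluation_cocycle x p = poly (coefficient x * p) 0"

lemmas field_action_simps = coefficient_simps scaleR_real_poly lie_derivative_def trivial_action_def
  second_derivative_cocycle_def divergence_cocycle_def evaluation_cocycle_def
  pderiv_add pderiv_diff pderiv_smult pderiv_mult smult_add_left smult_add_right smult_diff_right

interpretation forms: lie_module lie_derivative
  by (intro lie_module.intro linearI) (simp_all add: field_action_simps algebra_simps)

interpretation trivial: lie_module trivial_action
  by (intro lie_module.intro linearI) (simp_all add: field_action_simps)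

interpretation second: hom_cocycle lie_derivative trivial_action second_derivative_cocycle
  by (intro hom_cocycle.intro forms.lie_module_axioms trivial.lie_module_axioms hom_cocycle_axioms.intro linearI)
    (simp_all add: field_action_simps algebra_simps)

interpretation divergence: hom_cocycle lie_derivative lie_derivative divergence_cocycle
  by (intro hom_cocycle.intro forms.lie_module_axioms hom_cocycle_axioms.intro linearI)
    (simp_all add: field_action_simps algebra_simps)

interpretation evaluation: hom_cocycle trivial_action lie_derivative evaluation_cocycle
  by (intro hom_cocycle.intro forms.lie_module_axioms trivial.lie_module_axioms hom_cocycle_axioms.intro linearI)
    (simp_all add: field_action_simps algebra_simps)

text \<open>The Yoneda product of the three extended cocycles.\<close>

definition gv_cocycle ::
  "poly_vector_field uea \<Rightarrow> poly_vector_field uea \<Rightarrow> poly_vector_field uea \<Rightarrow> real"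
  where "gv_cocycle u v w = evaluation.ucocycle u (divergence.ucocycle v (second.ucocycle w 1))"

interpretation gv: trivial_coefficient_cocycle gv_cocycle "\<lambda>u. trivial.uact u 1"
proof (rule trivial_coefficient_cocycle.intro)
  fix a b c d :: "poly_vector_field uea"
  show "linear (\<lambda>a. gv_cocycle a b c)"
    unfolding gv_cocycle_def by (rule evaluation.linear_ucocycle_left)
  show "linear (\<lambda>b. gv_cocycle a b c)"
    using linear_compose[OF divergence.linear_ucocycle_left evaluation.linear_ucocycle_right]
    by (simp add: gv_cocycle_def o_def)
  show "linear (gv_cocycle a b)"
    using linear_compose[OF second.linear_ucocycle_left linear_compose
        [OF divergence.linear_ucocycle_right evaluation.linear_ucocycle_right]]
    by (simp add: gv_cocycle_def[abs_def] o_def)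
  have trivial: "trivial.uact u r = trivial.uact u 1 *\<^sub>R r" for u r
    using linear_scale[OF trivial.linear_uact_right, of u r 1] by simp
  have "second.ucocycle c (trivial.uact d 1) = trivial.uact d 1 *\<^sub>R second.ucocycle c 1"
    using linear_scale[OF second.linear_ucocycle_right, of c "trivial.uact d 1" 1] by simp
  \<comment> \<open>by the Leibniz rules the left-hand side telescopes to the two outer terms\<close>
  then show "gv_cocycle (a * b) c d - gv_cocycle a (b * c) d + gv_cocycle a b (c * d) =
      trivial.uact a 1 * gv_cocycle b c d + gv_cocycle a b c * trivial.uact d 1"
    using trivial[of a "gv_cocycle b c d"]
    by (simp add: gv_cocycle_def evaluation.ucocycle_times divergence.ucocycle_times second.ucocycle_times
        linear_add[OF evaluation.linear_ucocycle_right] linear_add[OF divergence.linear_ucocycle_right]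
        linear_scale[OF evaluation.linear_ucocycle_right] linear_scale[OF divergence.linear_ucocycle_right])
qed

lemma gv_cocycle_inclusion:
  "gv_cocycle (uea_inclusion x) (uea_inclusion y) (uea_inclusion z) =
     poly (coefficient x * (pderiv (coefficient y) * pderiv (pderiv (coefficient z)))) 0"
  by (simp add: gv_cocycle_def evaluation.ucocycle_inclusion divergence.ucocycle_inclusion
      second.ucocycle_inclusion field_action_simps)

section \<open>The Godbillon-Vey class\<close>

lemma lie_product_lie_bracket: "lie_product (lie_bracket :: 'g::lie_algebra \<Rightarrow> 'g \<Rightarrow> 'g)"
proof (intro lie_product.intro lie_product_axioms.intro bilinear_product.intro linearI)
  fix x y z :: 'g
  have anti: "lie_bracket x y = - lie_bracket y x" for x y :: 'g
  proof -
    have "lie_bracket (x + y) (x + y) =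
        (lie_bracket x x + lie_bracket y x) + (lie_bracket x y + lie_bracket y y)"
      by (simp only: lie_bracket_add_left lie_bracket_add_right)
    then have "lie_bracket y x + lie_bracket x y = 0" by (simp only: lie_bracket_self add_0_left add_0_right)
    then have "lie_bracket x y + lie_bracket y x = 0" by (simp only: add.commute)
    then show ?thesis by (simp add: eq_neg_iff_add_eq_0)
  qed
  have neg: "lie_bracket x (- y) = - lie_bracket x y" for x y :: 'g
    using lie_bracket_scaleR_right[of x "-1" y] by simp
  show "lie_bracket x (lie_bracket y z) =
      lie_bracket (lie_bracket x y) z - lie_bracket (lie_bracket x z) y"
    using jacobi[of x y z] anti[of "lie_bracket x y" z] anti[of "lie_bracket x z" y] anti[of z x]
    by (simp add: neg algebra_simps add_eq_0_iff)
qed (simp_all add: lie_bracket_add_left lie_bracket_add_right lie_bracket_scaleR_left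
    lie_bracket_scaleR_right lie_bracket_self)

lemma lie_product_map_uea_inclusion:
  "lie_product_map (lie_bracket :: 'g::lie_algebra \<Rightarrow> 'g \<Rightarrow> 'g) commutator uea_inclusion"
  by (intro lie_product_map.intro lie_product_map_axioms.intro lie_product_lie_bracket
      lie_product_commutator linear_uea_inclusion uea_inclusion_bracket)

definition gv_leibniz_cycle :: "poly_vector_field tensor" where
  "gv_leibniz_cycle =
     (1/2) *\<^sub>R tensor_of [e_field (-1), e_field 0, e_field 1]
     - (1/2) *\<^sub>R tensor_of [e_field 0, e_field (-1), e_field 1]
     + (1/6) *\<^sub>R tensor_of [e_field (-1), e_field (-1), e_field 2]"

lemma e_field_brackets:
  "lie_bracket (e_field (-1)) (e_field 0) = e_field (-1)"
  "lie_bracket (e_field 0) (e_field (-1)) = - e_field (-1)"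
  "lie_bracket (e_field (-1)) (e_field 1) = 2 *\<^sub>R e_field 0"
  "lie_bracket (e_field 0) (e_field 1) = e_field 1"
  "lie_bracket (e_field (-1)) (e_field 2) = 3 *\<^sub>R e_field 1"
  "lie_bracket (e_field (-1)) (e_field (-1)) = 0"
  unfolding e_field_def lie_bracket_monomials by (simp_all add: numeral_2_eq_2)

lemma boundary_gv_leibniz_cycle: "boundary (leibniz_complex lie_bracket) gv_leibniz_cycle = 0"
proof -
  interpret lie_product "lie_bracket :: poly_vector_field \<Rightarrow> _" by (rule lie_product_lie_bracket)
  note d = linear_boundary_leibniz
  show ?thesis
    by (simp add: gv_leibniz_cycle_def linear_add[OF d] linear_diff[OF d] linear_scale[OF d]
        boundary_leibniz_tensor_of leibniz_sum_3 e_field_brackets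
        linear_scale[OF linear_tensor_of_2(1)] linear_scale[OF linear_tensor_of_2(2)]
        linear_neg[OF linear_tensor_of_2(1)] linear_0[OF linear_tensor_of_2(1)]
        scaleR_add_right scaleR_diff_right)
qed

lemma abs_exterior_gv_leibniz_cycle:
  "abs_exterior gv_leibniz_cycle = wedge [e_field (-1), e_field 0, e_field 1]"
proof -
  have "wedge [e_field 0, e_field (-1), e_field 1] = - wedge [e_field (-1), e_field 0, e_field 1]"
    using alternating_swap_adjacent[OF alternating_wedge, of 0 "[0, 0, e_field 1]" "e_field 0" "e_field (-1)"]
    by (simp add: eq_neg_iff_add_eq_0)
  moreover have "wedge ([] @ e_field (-1) # e_field (-1) # [e_field 2]) = 0"
    using alternating_wedge unfolding alternating_def by blast
  ultimately show ?thesis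
    by (simp add: gv_leibniz_cycle_def linear_add[OF linear_abs_exterior] linear_diff[OF linear_abs_exterior]
        linear_scale[OF linear_abs_exterior] flip: wedge_def scaleR_left_distrib)
qed

text \<open>Among the six orderings of \<open>1\<close>, \<open>x\<close>, \<open>x\<^sup>2\<close> only this one has \<open>f(0) g'(0) h''(0) \<noteq> 0\<close>.\<close>

lemma gv_cyclic_functional:
  "gv.cyclic_functional (phi_chain (tensor_of (map uea_inclusion [e_field (-1), e_field 0, e_field 1]))) = 2"
proof -
  have e: "coefficient (e_field (-1)) = 1" "coefficient (e_field 0) = [:0, 1:]" "coefficient (e_field 1) = [:0, 0, 1:]"
    by (simp_all add: e_field_def vector_field_inverse monom_altdef numeral_2_eq_2)
  show ?thesis
    by (simp add: phi_chain_tensor_of antisymmetrize_3 linear_diff[OF gv.linear_cyclic_functional]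
        gv.cyclic_functional_tensor_of gv.cyclic_sum_def gv_cocycle_inclusion e pderiv_pCons)
qed

theorem corollary3p6:
  shows
    "pi_star W_bracket 3 \<in> hom (HL W_bracket 3) (HLie W_bracket 3) \<and>
     mu1 3 \<in> hom (HL W_bracket 3) (HL U_bracket 3) \<and>
     mu2 3 \<in> hom (HLie W_bracket 3) (HLie U_bracket 3) \<and>
     pi_star U_bracket 3 \<in> hom (HL U_bracket 3) (HLie U_bracket 3) \<and>
     phi_star 2 \<in> hom (HL U_bracket 3) (HH_U 2) \<and>
     theta_star 2 \<in> hom (HLie U_bracket 3) (HC_U 2) \<and>
     I_star 2 \<in> hom (HH_U 2) (HC_U 2) \<and>
     (\<forall>c \<in> carrier (HL W_bracket 3). mu2 3 (pi_star W_bracket 3 c) = pi_star U_bracket 3 (mu1 3 c)) \<and>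
     (\<forall>c \<in> carrier (HL U_bracket 3). theta_star 2 (pi_star U_bracket 3 c) = I_star 2 (phi_star 2 c)) \<and>
     (\<exists>c \<in> carrier (HL W_bracket 3).
       pi_star W_bracket 3 c = godbillon_vey \<and>
       c \<noteq> \<one>\<^bsub>HL W_bracket 3\<^esub> \<and>
       godbillon_vey \<noteq> \<one>\<^bsub>HLie W_bracket 3\<^esub> \<and>
       mu1 3 c \<noteq> \<one>\<^bsub>HL U_bracket 3\<^esub> \<and>
       mu2 3 godbillon_vey \<noteq> \<one>\<^bsub>HLie U_bracket 3\<^esub> \<and>
       phi_star 2 (mu1 3 c) \<noteq> \<one>\<^bsub>HH_U 2\<^esub> \<and>
       theta_star 2 (mu2 3 godbillon_vey) \<noteq> \<one>\<^bsub>HC_U 2\<^esub>)"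
proof -
  interpret W: lie_product W_bracket by (rule lie_product_lie_bracket)
  interpret U: lie_product U_bracket by (rule lie_product_commutator)
  interpret incl: lie_product_map W_bracket U_bracket uea_inclusion by (rule lie_product_map_uea_inclusion)
  interpret piW: segment_map "leibniz_complex W_bracket" 3 "lie_complex W_bracket" 3 abs_exterior
    by (rule W.segment_map_projection)
  interpret piU: segment_map "leibniz_complex U_bracket" 3 "lie_complex U_bracket" 3 abs_exterior
    by (rule U.segment_map_projection)
  interpret mu1: segment_map "leibniz_complex W_bracket" 3 "leibniz_complex U_bracket" 3 "tensor_map uea_inclusion"
    by (rule incl.segment_map_tensor_map)
  interpret mu2: segment_map "lie_complex W_bracket" 3 "lie_complex U_bracket" 3 "exterior_map uea_inclusion"
    by (rule incl.segment_map_exterior_map)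
  interpret phi: segment_map "leibniz_complex U_bracket" 3 hochschild_complex 2 phi_chain
    by (rule segment_map_phi)
  interpret theta: segment_map "lie_complex U_bracket" 3 cyclic_complex 2 theta_chain
    by (rule segment_map_theta)
  interpret I: segment_map "hochschild_complex :: poly_vector_field uea tensor chain_cx" 2 cyclic_complex 2 abs_cyclic_tensor
    by (rule segment_map_cyclic_projection)
  note maps = pi_star_def mu1_def mu2_def phi_star_def theta_star_def I_star_def
  note on_classes = piW.induced_map_class piU.induced_map_class mu1.induced_map_class mu2.induced_map_class
    phi.induced_map_class theta.induced_map_class I.induced_map_class
  have homs: "pi_star W_bracket 3 \<in> hom (HL W_bracket 3) (HLie W_bracket 3)"
    "mu1 3 \<in> hom (HL W_bracket 3) (HL U_bracket 3)"
    "mu2 3 \<in> hom (HLie W_bracket 3) (HLie U_bracket 3)"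
    "pi_star U_bracket 3 \<in> hom (HL U_bracket 3) (HLie U_bracket 3)"
    "phi_star 2 \<in> hom (HL U_bracket 3) (HH_U 2)"
    "theta_star 2 \<in> hom (HLie U_bracket 3) (HC_U 2)"
    "I_star 2 \<in> hom (HH_U 2) (HC_U 2)"
    unfolding maps by (fact piW.induced_map_hom mu1.induced_map_hom mu2.induced_map_hom
        piU.induced_map_hom phi.induced_map_hom theta.induced_map_hom I.induced_map_hom)+
  have ones: "pi_star W_bracket 3 \<one>\<^bsub>HL W_bracket 3\<^esub> = \<one>\<^bsub>HLie W_bracket 3\<^esub>"
    "mu2 3 \<one>\<^bsub>HLie W_bracket 3\<^esub> = \<one>\<^bsub>HLie U_bracket 3\<^esub>"
    "pi_star U_bracket 3 \<one>\<^bsub>HL U_bracket 3\<^esub> = \<one>\<^bsub>HLie U_bracket 3\<^esub>"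
    "theta_star 2 \<one>\<^bsub>HLie U_bracket 3\<^esub> = \<one>\<^bsub>HC_U 2\<^esub>"
    "I_star 2 \<one>\<^bsub>HH_U 2\<^esub> = \<one>\<^bsub>HC_U 2\<^esub>"
    unfolding maps by (fact piW.induced_map_one mu2.induced_map_one piU.induced_map_one
        theta.induced_map_one I.induced_map_one)+
  have upper: "mu2 3 (pi_star W_bracket 3 c) = pi_star U_bracket 3 (mu1 3 c)"
    if "c \<in> carrier (HL W_bracket 3)" for c
    using that unfolding piW.source.carrier_homology maps
    by (auto simp: on_classes incl.exterior_map_abs)
  have lower: "theta_star 2 (pi_star U_bracket 3 c) = I_star 2 (phi_star 2 c)"
    if "c \<in> carrier (HL U_bracket 3)" for c
    using that unfolding piU.source.carrier_homology maps
    by (auto simp: on_classes theta_chain_abs)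
  define c where "c = homology_class (leibniz_complex W_bracket) 3 gv_leibniz_cycle"
  have c: "c \<in> carrier (HL W_bracket 3)"
    unfolding c_def piW.source.carrier_homology
    by (intro imageI CollectI conjI boundary_gv_leibniz_cycle)
      (auto simp: leibniz_complex_def gv_leibniz_cycle_def
        intro!: subspace_add subspace_diff subspace_scale subspace_tensor_power tensor_of_mem_tensor_power)
  have pi_c: "pi_star W_bracket 3 c = godbillon_vey"
    by (simp add: maps on_classes c_def godbillon_vey_def abs_exterior_gv_leibniz_cycle)
  let ?t = "phi_chain (tensor_of (map uea_inclusion [e_field (-1), e_field 0, e_field 1]))"
  have image: "theta_star 2 (mu2 3 godbillon_vey) = homology_class cyclic_complex 2 (abs_cyclic_tensor ?t)"
    by (simp only: maps on_classes godbillon_vey_def wedge_def incl.exterior_map_abs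
        incl.tensor_map_tensor_of theta_chain_abs)
  \<comment> \<open>the only place where a cocycle is evaluated; all other classes map to this one\<close>
  have theta_ne: "theta_star 2 (mu2 3 godbillon_vey) \<noteq> \<one>\<^bsub>HC_U 2\<^esub>"
  proof -
    have "abs_cyclic_tensor ?t \<notin> boundaries cyclic_complex 2"
      by (rule gv.cyclic_class_nonzero) (simp only: gv_cyclic_functional)
    then show ?thesis
      unfolding image theta.target.one_homology using theta.target.self_mem_homology_class by blast
  qed
  have mu2_ne: "mu2 3 godbillon_vey \<noteq> \<one>\<^bsub>HLie U_bracket 3\<^esub>" using theta_ne ones by metis
  have gv_ne: "godbillon_vey \<noteq> \<one>\<^bsub>HLie W_bracket 3\<^esub>" using mu2_ne ones by metis
  have c_ne: "c \<noteq> \<one>\<^bsub>HL W_bracket 3\<^esub>" using gv_ne pi_c ones by metis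
  have mu1_ne: "mu1 3 c \<noteq> \<one>\<^bsub>HL U_bracket 3\<^esub>" using mu2_ne pi_c upper[OF c] ones by metis
  have "mu1 3 c \<in> carrier (HL U_bracket 3)" by (rule hom_in_carrier[OF homs(2) c])
  then have "I_star 2 (phi_star 2 (mu1 3 c)) = theta_star 2 (mu2 3 godbillon_vey)"
    using lower upper[OF c] pi_c by metis
  then have phi_ne: "phi_star 2 (mu1 3 c) \<noteq> \<one>\<^bsub>HH_U 2\<^esub>" using theta_ne ones by metis
  show ?thesis
    using homs upper lower c pi_c c_ne gv_ne mu1_ne mu2_ne phi_ne theta_ne by blast
qed

end
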